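(* Let $n\ge1$ and $\delta>0$. Let $b\in H^{\sigma}(\mathbf{T}^n)$ with $\sigma\in\mathbb{R}$. For $\beta<n+4$ and $t\ge0$ let $U^{\delta,\beta}(t)$ be the solution of the nonlocal wave equation $\frac{d^2}{dt^2}U=L^{\delta,\beta}U+b$ with zero initial data $U(0)=0$, $\frac{d}{dt}U(0)=0$, given by $$U^{\delta,\beta}(t)=\hat b_0\frac{t^2}{2}+\sum_{0\ne k\in\mathbb{Z}^n}\frac{\hat b_k}{m_k}\left[\cos(\sqrt{-m_k}\,t)-1\right]e^{ik\cdot x}\in H^s(\mathbf{T}^n),$$ and let $U(t)$ be the solution of the local wave equation $\frac{d^2}{dt^2}U=\Delta U+b$ with zero initial data, given by $$U(t)=\hat b_0\frac{t^2}{2}+\sum_{0\ne k\in\mathbb{Z}^n}\frac{\hat b_k}{-\|k\|^2}\left[\cos(\|k\|t)-1\right]e^{ik\cdot x}\in H^{s'}(\mathbf{T}^n),$$ where $s'=\sigma+2$ and $s=\sigma+\max\{0,\beta-n\}$. Then for any $t\ge0$ and any $\varepsilon\in(0,2)$ with $\varepsilon<n/2$, $$\lim_{\beta\to n+2}U^{\delta,\beta}(t)=U(t)\quad\text{in }H^{s_0}(\mathbf{T}^n),$$ where $s_0=\sigma+2-\varepsilon$.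
   Context: For $k\in\mathbb{Z}^n$, $m_k=m^{\delta,\beta}(k)$, where for $\nu\in\mathbb{R}^n$ $$m^{\delta,\beta}(\nu)=-\|\nu\|^2\,{}_2F_3\!\left(1,\tfrac{n+2-\beta}{2};2,\tfrac{n+2}{2},\tfrac{n+4-\beta}{2};-\tfrac14\|\nu\|^2\delta^2\right),$$ ${}_2F_3(a_1,a_2;b_1,b_2,b_3;z)=\sum_{j\ge0}\frac{(a_1)_j(a_2)_j}{(b_1)_j(b_2)_j(b_3)_j}\frac{z^j}{j!}$, $(a)_j=a(a+1)\cdots(a+j-1)$. For $\beta<n+4$ one has $m_k<0$ for all $k\neq0$. The nonlocal Laplacian acts on periodic distributions by $L^{\delta,\beta}\big(\sum_k\hat T_ke^{ik\cdot x}\big)=\sum_km_k\hat T_ke^{ik\cdot x}$. $\mathbf{T}^n=\prod_{j=1}^n[0,2\pi]$ is the periodic torus; a periodic distribution $g$ is written $g=\sum_{k\in\mathbb{Z}^n}\hat g_ke^{ik\cdot x}$ with Fourier coefficients $\hat g_k$; for $q\in\mathbb{R}$, $H^q(\mathbf{T}^n)$ is the space of periodic distributions with $\|g\|_{H^q(\mathbf{T}^n)}^2=\sum_{k\in\mathbb{Z}^n}(1+\|k\|^2)^q|\hat g_k|^2<\infty$. The limit $\beta\to n+2$ is two-sided. *)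

theory Defs
  imports "HOL-Analysis.Analysis"
begin

section \<open>Periodic test functions and distributions\<close>

definition lattice_vec :: "int^'n \<Rightarrow> real^'n" where
  "lattice_vec k = (\<chi> i. real_of_int (k $ i))"

definition character :: "int^'n \<Rightarrow> real^'n \<Rightarrow> complex" where
  "character k x = exp (\<i> * complex_of_real (lattice_vec k \<bullet> x))"

definition torus :: "(real^'n) set" where
  "torus = cbox 0 (\<chi> i. 2 * pi)"

definition partial_deriv :: "'n \<Rightarrow> (real^'n \<Rightarrow> complex) \<Rightarrow> real^'n \<Rightarrow> complex" where
  "partial_deriv i f x = vector_derivative (\<lambda>h. f (x + h *\<^sub>R axis i 1)) (at 0)"

definition iterated_partial :: "'n list \<Rightarrow> (real^'n \<Rightarrow> complex) \<Rightarrow> real^'n \<Rightarrow> complex" where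
  "iterated_partial js f = foldr partial_deriv js f"

text \<open>Smooth functions that are \<open>2 * pi\<close>-periodic in every coordinate. Iterated partial
  derivatives are indexed by lists of coordinate directions.\<close>

definition test_functions :: "(real^'n \<Rightarrow> complex) set" where
  "test_functions =
     {\<phi>. (\<forall>js. iterated_partial js \<phi> differentiable_on UNIV) \<and>
         (\<forall>k x. \<phi> (x + (2 * pi) *\<^sub>R lattice_vec k) = \<phi> x)}"

definition Ck_norm :: "nat \<Rightarrow> (real^'n \<Rightarrow> complex) \<Rightarrow> real" where
  "Ck_norm N \<phi> = (\<Sum>js | length js \<le> N. SUP x. cmod (iterated_partial js \<phi> x))"

text \<open>A distribution is a continuous linear functional on the test functions. It is represented by
  a total function that is zero off the test functions, so that equality of functions is equality
  of distributions.\<close>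

definition periodic_distributions :: "((real^'n \<Rightarrow> complex) \<Rightarrow> complex) set" where
  "periodic_distributions =
     {T. (\<forall>\<phi>. \<phi> \<notin> test_functions \<longrightarrow> T \<phi> = 0) \<and>
         (\<forall>\<phi>\<in>test_functions. \<forall>\<psi>\<in>test_functions. T (\<lambda>x. \<phi> x + \<psi> x) = T \<phi> + T \<psi>) \<and>
         (\<forall>c. \<forall>\<phi>\<in>test_functions. T (\<lambda>x. c * \<phi> x) = c * T \<phi>) \<and>
         (\<exists>C N. \<forall>\<phi>\<in>test_functions. cmod (T \<phi>) \<le> C * Ck_norm N \<phi>)}"

text \<open>A function \<open>f\<close> on the torus acts by \<open>\<phi> \<mapsto> integral torus (\<lambda>x. f x * \<phi> x)\<close>. With this
  convention the two definitions below are the Fourier coefficients of a distribution and the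
  distribution given by the trigonometric series with coefficients \<open>c\<close>.\<close>

definition fourier_coeff :: "((real^'n \<Rightarrow> complex) \<Rightarrow> complex) \<Rightarrow> int^'n \<Rightarrow> complex" where
  "fourier_coeff T k = T (character (- k)) / complex_of_real ((2 * pi) ^ CARD('n))"

definition fourier_series :: "(int^'n \<Rightarrow> complex) \<Rightarrow> (real^'n \<Rightarrow> complex) \<Rightarrow> complex" where
  "fourier_series c \<phi> =
     (if \<phi> \<in> test_functions
      then \<Sum>\<^sub>\<infinity>k\<in>UNIV. c k * integral torus (\<lambda>x. character k x * \<phi> x) else 0)"

section \<open>Sobolev spaces\<close>

definition sobolev_term :: "real \<Rightarrow> ((real^'n \<Rightarrow> complex) \<Rightarrow> complex) \<Rightarrow> int^'n \<Rightarrow> real" where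
  "sobolev_term q T k =
     (1 + (norm (lattice_vec k))\<^sup>2) powr q * (cmod (fourier_coeff T k))\<^sup>2"

definition sobolev :: "real \<Rightarrow> ((real^'n \<Rightarrow> complex) \<Rightarrow> complex) set" where
  "sobolev q = {T \<in> periodic_distributions. sobolev_term q T summable_on UNIV}"

definition sobolev_norm :: "real \<Rightarrow> ((real^'n \<Rightarrow> complex) \<Rightarrow> complex) \<Rightarrow> real" where
  "sobolev_norm q T = sqrt (\<Sum>\<^sub>\<infinity>k\<in>UNIV. sobolev_term q T k)"

text \<open>Membership is required explicitly since \<^const>\<open>infsum\<close> of a non-summable family is zero.\<close>

definition tendsto_sobolev ::
  "real \<Rightarrow> ('a \<Rightarrow> (real^'n \<Rightarrow> complex) \<Rightarrow> complex) \<Rightarrow> ((real^'n \<Rightarrow> complex) \<Rightarrow> complex)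
     \<Rightarrow> 'a filter \<Rightarrow> bool" where
  "tendsto_sobolev q S T F \<longleftrightarrow>
     T \<in> sobolev q \<and> (\<forall>\<^sub>F a in F. S a \<in> sobolev q) \<and>
     ((\<lambda>a. sobolev_norm q (\<lambda>\<phi>. S a \<phi> - T \<phi>)) \<longlongrightarrow> 0) F"

section \<open>Local and nonlocal Laplacians\<close>

definition hyp2F3 :: "real \<Rightarrow> real \<Rightarrow> real \<Rightarrow> real \<Rightarrow> real \<Rightarrow> real \<Rightarrow> real" where
  "hyp2F3 a1 a2 b1 b2 b3 z =
     (\<Sum>j. pochhammer a1 j * pochhammer a2 j /
            (pochhammer b1 j * pochhammer b2 j * pochhammer b3 j) * (z ^ j / fact j))"

definition multiplier :: "real \<Rightarrow> real \<Rightarrow> real^'n \<Rightarrow> real" where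
  "multiplier \<delta> \<beta> \<nu> =
     - (norm \<nu>)\<^sup>2 *
     hyp2F3 1 ((real CARD('n) + 2 - \<beta>) / 2)
       2 ((real CARD('n) + 2) / 2) ((real CARD('n) + 4 - \<beta>) / 2)
       (- (1 / 4) * (norm \<nu>)\<^sup>2 * \<delta>\<^sup>2)"

definition nonlocal_laplacian ::
  "real \<Rightarrow> real \<Rightarrow> ((real^'n \<Rightarrow> complex) \<Rightarrow> complex) \<Rightarrow> (real^'n \<Rightarrow> complex) \<Rightarrow> complex" where
  "nonlocal_laplacian \<delta> \<beta> T =
     fourier_series (\<lambda>k. complex_of_real (multiplier \<delta> \<beta> (lattice_vec k)) * fourier_coeff T k)"

definition laplacian ::
  "((real^'n \<Rightarrow> complex) \<Rightarrow> complex) \<Rightarrow> (real^'n \<Rightarrow> complex) \<Rightarrow> complex" where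
  "laplacian T \<phi> =
     (if \<phi> \<in> test_functions
      then T (\<lambda>x. \<Sum>i\<in>UNIV. partial_deriv i (partial_deriv i \<phi>) x) else 0)"

section \<open>Wave equations\<close>

text \<open>\<open>U'' = A U + b\<close> on \<open>{0..}\<close> with \<open>U 0 = U' 0 = 0\<close>, where the time derivatives (one-sided at
  \<open>0\<close>) are limits of difference quotients in the Sobolev space of order \<open>q\<close>; \<open>V\<close> is the first
  derivative.\<close>

definition solves_wave ::
  "real \<Rightarrow> (((real^'n \<Rightarrow> complex) \<Rightarrow> complex) \<Rightarrow> (real^'n \<Rightarrow> complex) \<Rightarrow> complex)
     \<Rightarrow> ((real^'n \<Rightarrow> complex) \<Rightarrow> complex) \<Rightarrow> (real \<Rightarrow> (real^'n \<Rightarrow> complex) \<Rightarrow> complex) \<Rightarrow> bool" where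
  "solves_wave q A b U \<longleftrightarrow>
     (\<exists>V. (\<forall>\<phi>. U 0 \<phi> = 0) \<and> (\<forall>\<phi>. V 0 \<phi> = 0) \<and>
       (\<forall>t\<ge>0. U t \<in> sobolev q \<and> V t \<in> sobolev q \<and>
          tendsto_sobolev q (\<lambda>h \<phi>. (U (t + h) \<phi> - U t \<phi>) / complex_of_real h)
            (V t) (at 0 within {-t..}) \<and>
          tendsto_sobolev q (\<lambda>h \<phi>. (V (t + h) \<phi> - V t \<phi>) / complex_of_real h)
            (\<lambda>\<phi>. A (U t) \<phi> + b \<phi>) (at 0 within {-t..})))"

definition nonlocal_wave ::
  "real \<Rightarrow> real \<Rightarrow> ((real^'n \<Rightarrow> complex) \<Rightarrow> complex) \<Rightarrow> real
     \<Rightarrow> (real^'n \<Rightarrow> complex) \<Rightarrow> complex" where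
  "nonlocal_wave \<delta> \<beta> b t =
     fourier_series (\<lambda>k.
       if k = 0 then fourier_coeff b 0 * complex_of_real (t\<^sup>2 / 2)
       else let m = multiplier \<delta> \<beta> (lattice_vec k) in
         fourier_coeff b k / complex_of_real m * complex_of_real (cos (sqrt (- m) * t) - 1))"

definition local_wave ::
  "((real^'n \<Rightarrow> complex) \<Rightarrow> complex) \<Rightarrow> real \<Rightarrow> (real^'n \<Rightarrow> complex) \<Rightarrow> complex" where
  "local_wave b t =
     fourier_series (\<lambda>k.
       if k = 0 then fourier_coeff b 0 * complex_of_real (t\<^sup>2 / 2)
       else fourier_coeff b k / complex_of_real (- (norm (lattice_vec k))\<^sup>2) *
         complex_of_real (cos (norm (lattice_vec k) * t) - 1))"

end

theory Submission
  imports Defs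
begin

text \<open>
  Write \<open>n\<close> for the dimension, \<open>a = (n + 2 - \<beta>) / 2 > -1\<close> and \<open>z = \<parallel>k\<parallel>\<^sup>2 \<delta>\<^sup>2 / 4\<close>, so that
  \<open>m\<^sub>k = - \<parallel>k\<parallel>\<^sup>2 F\<^sub>a(z)\<close> with \<open>F\<^sub>a(z) = 2F3(1, a; 2, n/2 + 1, a + 1; -z)\<close>. Termwise,
  \<open>a F\<^sub>a + z F\<^sub>a' = a G\<close> for \<open>G(y) = 1F2(1; 2, n/2 + 1; -y)\<close>, that is,
  \<open>(z\<^sup>a (F\<^sub>a - c))' = a z\<^sup>a\<^sup>-\<^sup>1 (G - c)\<close>, and \<open>y G(y) = (n/2) (1 - \<Phi>(y))\<close> with
  \<open>\<Phi>(y) = 0F1(; n/2; -y)\<close>. The differential equation of \<open>\<Phi>\<close> has a decreasing energy, which gives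
  \<open>\<bar>\<Phi>\<bar> \<le> 1\<close> and hence \<open>0 \<le> G \<le> 1\<close> and \<open>G \<le> 1/2\<close> far out. By monotonicity \<open>F\<^sub>a\<close> is bounded below by a
  multiple of \<open>z\<^sup>-\<^sup>a\<close> for large \<open>z\<close>, uniformly as \<open>a\<close> decreases to \<open>0\<close>, and by \<open>1\<close> if \<open>a \<le> 0\<close>.

  Each Fourier mode of the solution is \<open>b\<^sub>k (1 - cos (\<omega> t)) / \<omega>\<^sup>2\<close> with \<open>\<omega>\<^sup>2 = - m\<^sub>k\<close>, at most
  \<open>min (t\<^sup>2 / 2) (2 / \<omega>\<^sup>2)\<close> times \<open>b\<^sub>k\<close>. The lower bounds on \<open>- m\<^sub>k\<close> therefore give the regularity and,
  with \<open>F\<^sub>a(z) \<rightarrow> 1\<close> as \<open>a \<rightarrow> 0\<close>, a summable majorant for dominated convergence of the Sobolev norms. The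
  time derivatives are limits by the same dominated convergence, with the mean value theorem
  bounding the difference quotients.
\<close>

section \<open>Hypergeometric bounds\<close>

text \<open>Comparison with the exponential series; this is why every hypergeometric series below
  converges for all arguments.\<close>

lemma summable_power_series_fact_bound:
  fixes c :: "nat \<Rightarrow> real"
  assumes "\<And>j. \<bar>c j\<bar> \<le> K / fact j"
  shows "summable (\<lambda>j. c j * y ^ j)"
proof (rule summable_comparison_test')
  show "summable (\<lambda>j. K * (inverse (fact j) * \<bar>y\<bar> ^ j))"
    by (intro summable_mult summable_exp)
  show "norm (c j * y ^ j) \<le> K * (inverse (fact j) * \<bar>y\<bar> ^ j)" for j
    using mult_right_mono[OF assms[of j], of "\<bar>y\<bar> ^ j"]
    by (simp add: abs_mult power_abs field_simps)
qed

text \<open>Only the factor of index 0 can be below 1, and it is at least 1/2. The threshold admits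
  the parameter n/2 in dimension one.\<close>

lemma pochhammer_ge_half:
  fixes v :: real
  assumes "v \<ge> 1/2"
  shows "pochhammer v j \<ge> 1/2"
proof (induction j)
  case (Suc j)
  show ?case
  proof (cases j)
    case 0
    then show ?thesis using assms by simp
  next
    case (Suc i)
    then have "v + real j \<ge> 1" using assms by simp
    then have "pochhammer v j * (v + real j) \<ge> (1/2) * 1"
      using Suc.IH by (intro mult_mono) auto
    then show ?thesis by (simp add: pochhammer_Suc)
  qed
qed simp

lemma pochhammer_ge_1:
  fixes v :: real
  assumes "v \<ge> 1"
  shows "pochhammer v j \<ge> 1"
proof (induction j)
  case (Suc j)
  have "pochhammer v j * (v + real j) \<ge> 1 * 1"
    using Suc assms by (intro mult_mono) auto
  then show ?case by (simp add: pochhammer_Suc)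
qed simp

lemma pochhammer_shift:
  fixes a :: real
  shows "pochhammer a j * (a + real j) = a * pochhammer (a + 1) j"
  using pochhammer_rec[of a j] pochhammer_Suc[of a j] by simp

section \<open>The Bessel-type function 0F1 and its energy bound\<close>

text \<open>The sign of the argument is absorbed here: \<open>hyp0F1 v y\<close> is 0F1(; v; -y), a
  normalized Bessel function of order v - 1 at 2 sqrt(y). The coefficients have a name of their own
  so that \<open>diffs\<close> can act on them.\<close>

definition hyp0F1_coeff :: "real \<Rightarrow> nat \<Rightarrow> real" where
  "hyp0F1_coeff v j = (-1) ^ j / (fact j * pochhammer v j)"

definition hyp0F1 :: "real \<Rightarrow> real \<Rightarrow> real" where
  "hyp0F1 v y = (\<Sum>j. hyp0F1_coeff v j * y ^ j)"

lemma hyp0F1_coeff_bound: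
  assumes "v \<ge> 1/2"
  shows "\<bar>hyp0F1_coeff v j\<bar> \<le> 2 / fact j"
proof -
  have "pochhammer v j \<ge> 1/2" by (rule pochhammer_ge_half[OF assms])
  then have "fact j * 1 \<le> fact j * (2 * pochhammer v j)"
    by (intro mult_left_mono) auto
  moreover have "pochhammer v j > 0" using \<open>pochhammer v j \<ge> 1/2\<close> by linarith
  ultimately show ?thesis
    by (simp add: hyp0F1_coeff_def power_abs divide_simps)
qed

lemma hyp0F1_sums:
  assumes "v \<ge> 1/2"
  shows "(\<lambda>j. hyp0F1_coeff v j * y ^ j) sums hyp0F1 v y"
  unfolding hyp0F1_def
  by (intro summable_sums summable_power_series_fact_bound[OF hyp0F1_coeff_bound] assms)

lemma hyp0F1_0 [simp]: "hyp0F1 v 0 = 1"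
  unfolding hyp0F1_def powser_zero by (simp add: hyp0F1_coeff_def)

lemma hyp0F1_coeff_Suc:
  assumes "v > 0"
  shows "hyp0F1_coeff v (Suc j) = - hyp0F1_coeff (v + 1) j / (v * real (Suc j))"
  using assms by (simp add: hyp0F1_coeff_def pochhammer_rec divide_simps)

lemma DERIV_hyp0F1:
  assumes "v \<ge> 1/2"
  shows "(hyp0F1 v has_field_derivative - hyp0F1 (v + 1) y / v) (at y)"
proof -
  have v: "v > 0" using assms by simp
  have "diffs (hyp0F1_coeff v) = (\<lambda>j. - (1 / v) * hyp0F1_coeff (v + 1) j)"
  proof
    fix j
    show "diffs (hyp0F1_coeff v) j = - (1 / v) * hyp0F1_coeff (v + 1) j"
      using v unfolding diffs_def hyp0F1_coeff_Suc[OF v]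
      by (simp add: divide_simps)
  qed
  moreover have "((\<lambda>y. \<Sum>j. hyp0F1_coeff v j * y ^ j) has_field_derivative
      (\<Sum>j. diffs (hyp0F1_coeff v) j * y ^ j)) (at y)"
    by (intro termdiffs_strong_converges_everywhere
        summable_power_series_fact_bound[OF hyp0F1_coeff_bound] assms)
  moreover have "(\<Sum>j. - (1 / v) * hyp0F1_coeff (v + 1) j * y ^ j) = - (1 / v) * hyp0F1 (v + 1) y"
    using sums_mult[OF hyp0F1_sums[of "v + 1" y], of "- (1 / v)"] assms
    by (simp add: sums_iff mult.assoc)
  ultimately show ?thesis
    by (simp add: hyp0F1_def[abs_def])
qed

text \<open>Comparison of coefficients: those of index \<open>Suc j\<close> for v + 1 and for v
  differ by a multiple of the coefficient of index j for v + 2, while the constant terms, both 1,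
  cancel.\<close>

lemma hyp0F1_recurrence:
  assumes "v \<ge> 1/2"
  shows "y * hyp0F1 (v + 2) y = v * (v + 1) * (hyp0F1 (v + 1) y - hyp0F1 v y)"
proof -
  have v: "v > 0" using assms by simp
  let ?f = "\<lambda>j. v * (v + 1) * (hyp0F1_coeff (v + 1) j * y ^ j - hyp0F1_coeff v j * y ^ j)"
  have 1: "?f sums (v * (v + 1) * (hyp0F1 (v + 1) y - hyp0F1 v y))"
    using assms by (intro sums_mult sums_diff hyp0F1_sums) auto
  have "?f (Suc j) = y * (hyp0F1_coeff (v + 2) j * y ^ j)" for j
  proof -
    have p: "pochhammer (v + 2) j > 0" "pochhammer (v + 1) j > 0" using v by (auto intro: pochhammer_pos)
    have s: "pochhammer (v + 1) j * (v + 1 + real j) = (v + 1) * pochhammer (v + 2) j"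
      using pochhammer_shift[of "v + 1" j] by (simp add: add.assoc)
    have pp: "hyp0F1_coeff (v + 1) j = hyp0F1_coeff (v + 2) j * (v + 1 + real j) / (v + 1)"
      using p v s unfolding hyp0F1_coeff_def by (simp add: divide_simps) algebra
    have "hyp0F1_coeff (v + 1) (Suc j) - hyp0F1_coeff v (Suc j) =
        - hyp0F1_coeff (v + 2) j / ((v + 1) * real (Suc j)) + hyp0F1_coeff (v + 1) j / (v * real (Suc j))"
      using v by (simp add: hyp0F1_coeff_Suc add.assoc)
    also have "\<dots> = hyp0F1_coeff (v + 2) j / (v * (v + 1))"
      unfolding pp using v by (simp add: divide_simps) (simp add: algebra_simps)
    finally have "hyp0F1_coeff (v + 1) (Suc j) - hyp0F1_coeff v (Suc j) = hyp0F1_coeff (v + 2) j / (v * (v + 1))" .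
    moreover have "?f (Suc j) = v * (v + 1) * (hyp0F1_coeff (v + 1) (Suc j) - hyp0F1_coeff v (Suc j)) * y ^ Suc j"
      by (simp add: algebra_simps)
    ultimately show ?thesis using v by simp
  qed
  moreover have "(\<lambda>j. y * (hyp0F1_coeff (v + 2) j * y ^ j)) sums (y * hyp0F1 (v + 2) y)"
    using assms by (intro sums_mult hyp0F1_sums) auto
  ultimately have "(\<lambda>j. ?f (Suc j)) sums (y * hyp0F1 (v + 2) y)" by simp
  then have "?f sums (y * hyp0F1 (v + 2) y + ?f 0)" by (simp only: sums_Suc_iff[of ?f] add_diff_cancel)
  moreover have "?f 0 = 0" by (simp add: hyp0F1_coeff_def)
  ultimately have "?f sums (y * hyp0F1 (v + 2) y)" by (simp only: add_0_right)
  from sums_unique2[OF this 1] show ?thesis .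
qed

text \<open>With \<open>\<Phi> = hyp0F1 v\<close>, the recurrence is the equation \<open>y \<Phi>'' + v \<Phi>' + \<Phi> = 0\<close>, for which
  \<open>y \<Phi>'\<^sup>2 + \<Phi>\<^sup>2\<close> is a decreasing energy.\<close>

lemma abs_hyp0F1_le_1:
  assumes v: "v \<ge> 1/2" and y: "y \<ge> 0"
  shows "\<bar>hyp0F1 v y\<bar> \<le> 1"
proof -
  \<comment> \<open>Since \<open>hyp0F1 (v + 1) y / v\<close> is minus the derivative, this is the
    energy in terms of contiguous functions.\<close>
  define E where "E = (\<lambda>y. y * (hyp0F1 (v + 1) y)\<^sup>2 / v\<^sup>2 + (hyp0F1 v y)\<^sup>2)"
  have "E y \<le> E 0"
  proof (rule DERIV_nonpos_imp_nonincreasing[OF y])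
    fix x :: real assume "0 \<le> x" "x \<le> y"
    let ?p = "hyp0F1 (v + 1) x" and ?q = "hyp0F1 (v + 2) x" and ?r = "hyp0F1 v x"
    have d: "(hyp0F1 v has_field_derivative - ?p / v) (at x)"
      "(hyp0F1 (v + 1) has_field_derivative - ?q / (v + 1)) (at x)"
      using DERIV_hyp0F1[of v x] DERIV_hyp0F1[of "v + 1" x] v by (auto simp: add.assoc)
    have "(E has_field_derivative (?p\<^sup>2 + x * (2 * ?p * (- ?q / (v + 1)))) / v\<^sup>2 + 2 * ?r * (- ?p / v)) (at x)"
      unfolding E_def using v
      by (auto intro!: derivative_eq_intros d simp: power2_eq_square) argo
    moreover have "(?p\<^sup>2 + x * (2 * ?p * (- ?q / (v + 1)))) / v\<^sup>2 + 2 * ?r * (- ?p / v)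
        = ?p\<^sup>2 * (1 - 2 * v) / v\<^sup>2"
    proof -
      have "x * (2 * ?p * (- ?q / (v + 1))) = - (2 * ?p / (v + 1)) * (x * ?q)" by simp
      also have "\<dots> = - 2 * ?p * v * (?p - ?r)"
        unfolding hyp0F1_recurrence[OF v] using v by simp
      finally have e: "x * (2 * ?p * (- ?q / (v + 1))) = - 2 * ?p * v * (?p - ?r)" .
      show ?thesis unfolding e using v
        by (simp add: divide_simps power2_eq_square) (simp add: algebra_simps)
    qed
    \<comment> \<open>The derivative of the energy is 1 - 2 v times a square, so v \<ge> 1/2 decides
      its sign.\<close>
    moreover have "?p\<^sup>2 * (1 - 2 * v) / v\<^sup>2 \<le> 0"
      using v by (simp add: divide_nonpos_nonneg mult_nonneg_nonpos)
    ultimately show "\<exists>d. (E has_field_derivative d) (at x) \<and> d \<le> 0" by auto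
  qed
  moreover have "(hyp0F1 v y)\<^sup>2 \<le> E y" using y by (simp add: E_def)
  ultimately have "(hyp0F1 v y)\<^sup>2 \<le> 1" by (simp add: E_def)
  then show ?thesis by (simp add: abs_square_le_1)
qed

text \<open>The derivative of \<open>y / v + hyp0F1 v y\<close> is
  \<open>(1 - hyp0F1 (v + 1) y) / v\<close>, nonnegative by the energy bound for v + 1.\<close>

lemma one_minus_hyp0F1_le:
  assumes v: "v \<ge> 1/2" and y: "y \<ge> 0"
  shows "1 - hyp0F1 v y \<le> y / v"
proof -
  have "(\<lambda>y. y / v + hyp0F1 v y) 0 \<le> (\<lambda>y. y / v + hyp0F1 v y) y"
  proof (rule DERIV_nonneg_imp_nondecreasing[OF y])
    fix x :: real assume "0 \<le> x" "x \<le> y"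
    have "((\<lambda>y. y / v + hyp0F1 v y) has_field_derivative 1 / v + - hyp0F1 (v + 1) x / v) (at x)"
      using v by (auto intro!: derivative_eq_intros DERIV_hyp0F1)
    moreover have "hyp0F1 (v + 1) x \<le> 1"
      using abs_hyp0F1_le_1[of "v + 1" x] v \<open>0 \<le> x\<close> by simp
    then have "1 / v + - hyp0F1 (v + 1) x / v \<ge> 0" using v by (simp add: divide_simps)
    ultimately show "\<exists>d. ((\<lambda>y. y / v + hyp0F1 v y) has_field_derivative d) (at x) \<and> d \<ge> 0"
      by blast
  qed
  then show ?thesis by simp
qed

section \<open>The function G = 1F2(1; 2, v + 1; -y)\<close>

text \<open>The quotient (1)_j / ((2)_j j!) of the hypergeometric series equals 1/(j+1)!, hence
  \<open>fact (Suc j)\<close>.\<close>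

definition hyp1F2_coeff :: "real \<Rightarrow> nat \<Rightarrow> real" where
  "hyp1F2_coeff v j = (-1) ^ j / (fact (Suc j) * pochhammer (v + 1) j)"

definition hyp1F2 :: "real \<Rightarrow> real \<Rightarrow> real" where
  "hyp1F2 v y = (\<Sum>j. hyp1F2_coeff v j * y ^ j)"

lemma hyp1F2_coeff_bound:
  assumes "v \<ge> 0"
  shows "\<bar>hyp1F2_coeff v j\<bar> \<le> 1 / fact j"
proof -
  have p: "pochhammer (v + 1) j \<ge> 1" using assms by (intro pochhammer_ge_1) simp
  have f: "(fact j :: real) \<le> fact (Suc j)" by (rule fact_mono) simp
  have "fact j * 1 \<le> fact (Suc j) * pochhammer (v + 1) j"
    using f p by (intro mult_mono) auto
  then have "1 / (fact (Suc j) * pochhammer (v + 1) j) \<le> 1 / fact j"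
    by (intro divide_left_mono) (use p in \<open>auto simp del: fact_Suc intro!: mult_pos_pos\<close>)
  then show ?thesis using p
    by (simp add: hyp1F2_coeff_def power_abs abs_mult del: fact_Suc)
qed

lemma hyp1F2_sums:
  assumes "v \<ge> 0"
  shows "(\<lambda>j. hyp1F2_coeff v j * y ^ j) sums hyp1F2 v y"
  unfolding hyp1F2_def
  by (intro summable_sums summable_power_series_fact_bound[OF hyp1F2_coeff_bound] assms)

text \<open>Multiplication by y shifts the index, so the left side is the series of
  \<open>- v * hyp0F1 v y\<close> without its constant term - v.\<close>

lemma hyp1F2_eq_hyp0F1:
  assumes "v \<ge> 1/2"
  shows "y * hyp1F2 v y = v * (1 - hyp0F1 v y)"
proof -
  have v: "v > 0" using assms by simp
  let ?f = "\<lambda>j. - v * (hyp0F1_coeff v j * y ^ j)"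
  have "?f (Suc j) = y * (hyp1F2_coeff v j * y ^ j)" for j
    unfolding hyp0F1_coeff_Suc[OF v] using v
    by (simp add: hyp0F1_coeff_def hyp1F2_coeff_def divide_simps)
  moreover have "(\<lambda>j. y * (hyp1F2_coeff v j * y ^ j)) sums (y * hyp1F2 v y)"
    using v by (intro sums_mult hyp1F2_sums) auto
  ultimately have "(\<lambda>j. ?f (Suc j)) sums (y * hyp1F2 v y)" by simp
  then have "?f sums (y * hyp1F2 v y + ?f 0)" by (simp only: sums_Suc_iff[of ?f] add_diff_cancel)
  moreover have "?f sums (- v * hyp0F1 v y)" by (intro sums_mult hyp0F1_sums assms)
  moreover have "?f 0 = - v" by (simp add: hyp0F1_coeff_def)
  ultimately have "y * hyp1F2 v y + - v = - v * hyp0F1 v y" using sums_unique2 by metis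
  then show ?thesis by (simp add: algebra_simps)
qed

text \<open>All three come from y G = v (1 - \<Phi>). The bound 1 on the modulus of \<Phi> gives 0
  \<le> y G \<le> 2 v, hence G \<le> 1/2 once y \<ge> 4 v; and 1 - \<Phi> \<le> y / v gives G \<le>
  1.\<close>

lemma hyp1F2_bounds:
  assumes v: "v \<ge> 1/2" and y: "y > 0"
  shows "0 \<le> hyp1F2 v y" "hyp1F2 v y \<le> 1" "y \<ge> 4 * v \<Longrightarrow> hyp1F2 v y \<le> 1/2"
proof -
  have b: "\<bar>hyp0F1 v y\<bar> \<le> 1" using abs_hyp0F1_le_1[OF v] y by simp
  have eq: "hyp1F2 v y = v * (1 - hyp0F1 v y) / y"
    using hyp1F2_eq_hyp0F1[OF v, of y] y by (simp add: field_simps)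
  show "0 \<le> hyp1F2 v y" unfolding eq using b v y by (intro divide_nonneg_pos mult_nonneg_nonneg) auto
  show "hyp1F2 v y \<le> 1" unfolding eq using one_minus_hyp0F1_le[OF v, of y] v y
    by (simp add: field_simps)
  show "hyp1F2 v y \<le> 1/2" if "y \<ge> 4 * v"
  proof -
    have "v * (1 - hyp0F1 v y) \<le> v * 2" using b v by (intro mult_left_mono) auto
    then show ?thesis unfolding eq using that y by (simp add: divide_simps)
  qed
qed

section \<open>The reduced 2F3 function: monotonicity and lower bounds\<close>

text \<open>The quotient of Pochhammer symbols is \<open>a / (a + j)\<close>, except that it is \<open>1\<close> for \<open>a = j = 0\<close>.\<close>

definition red2F3_coeff :: "real \<Rightarrow> real \<Rightarrow> nat \<Rightarrow> real" where
  "red2F3_coeff v a j = hyp1F2_coeff v j * (pochhammer a j / pochhammer (a + 1) j)"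

definition red2F3 :: "real \<Rightarrow> real \<Rightarrow> real \<Rightarrow> real" where
  "red2F3 v a z = (\<Sum>j. red2F3_coeff v a j * z ^ j)"

lemma hyp2F3_eq_red2F3: "hyp2F3 1 a 2 (v + 1) (a + 1) (- z) = red2F3 v a z"
proof -
  have "pochhammer 1 j * pochhammer a j / (pochhammer 2 j * pochhammer (v + 1) j * pochhammer (a + 1) j)
      * ((- z) ^ j / fact j) = red2F3_coeff v a j * z ^ j" for j
  proof -
    have 1: "pochhammer 1 j = (fact j :: real)" by (rule pochhammer_fact[symmetric])
    have "pochhammer (1 :: real) (Suc j) = 1 * pochhammer (1 + 1) j" by (rule pochhammer_rec)
    then have 2: "pochhammer 2 j = (fact (Suc j) :: real)"
      unfolding pochhammer_fact[symmetric] by simp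
    show ?thesis
      unfolding red2F3_coeff_def hyp1F2_coeff_def power_minus[of z j] 1 2
      by (simp add: mult_ac del: fact_Suc)
  qed
  then show ?thesis unfolding hyp2F3_def red2F3_def by (simp only:)
qed

text \<open>This is (a)_j / (a + 1)_j = a / (a + j), multiplied out so that the case a = j = 0 is
  included.\<close>

lemma pochhammer_ratio:
  fixes a :: real
  assumes "a > -1"
  shows "(a + real j) * (pochhammer a j / pochhammer (a + 1) j) = a"
proof -
  have "pochhammer (a + 1) j > 0" using assms by (intro pochhammer_pos) simp
  then show ?thesis using pochhammer_shift[of a j] by (simp add: field_simps)
qed

text \<open>For j > 0 the denominator a + j is at least a + 1 > 0. The factor
  \<open>\<bar>a\<bar>\<close> makes all terms of the series but the first vanish as a tends to
  0.\<close>

lemma pochhammer_ratio_bound: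
  fixes a :: real
  assumes "a > -1" "j > 0"
  shows "\<bar>pochhammer a j / pochhammer (a + 1) j\<bar> \<le> \<bar>a\<bar> / (a + 1)"
proof -
  have 1: "a + real j \<ge> a + 1" "a + 1 > 0" using assms by auto
  have "\<bar>pochhammer a j / pochhammer (a + 1) j\<bar> = \<bar>a\<bar> / (a + real j)"
    using pochhammer_ratio[OF assms(1), of j] 1
    by (metis abs_mult abs_of_pos less_le_trans nonzero_mult_div_cancel_left less_irrefl)
  also have "\<dots> \<le> \<bar>a\<bar> / (a + 1)"
    using 1 by (intro divide_left_mono mult_pos_pos) auto
  finally show ?thesis .
qed

lemma red2F3_coeff_bound:
  assumes "v \<ge> 0" "a > -1" "j > 0"
  shows "\<bar>red2F3_coeff v a j\<bar> \<le> (\<bar>a\<bar> / (a + 1)) / fact j"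
proof -
  have "\<bar>red2F3_coeff v a j\<bar> \<le> (1 / fact j) * (\<bar>a\<bar> / (a + 1))"
    unfolding red2F3_coeff_def abs_mult[of "hyp1F2_coeff v j"]
    using assms by (intro mult_mono hyp1F2_coeff_bound pochhammer_ratio_bound) auto
  then show ?thesis by (simp add: mult.commute)
qed

lemma red2F3_coeff_0 [simp]: "red2F3_coeff v a 0 = 1"
  by (simp add: red2F3_coeff_def hyp1F2_coeff_def)

lemma red2F3_coeff_bound':
  assumes "v \<ge> 0" "a > -1"
  shows "\<bar>red2F3_coeff v a j\<bar> \<le> (1 + \<bar>a\<bar> / (a + 1)) / fact j"
proof (cases "j = 0")
  case True
  then show ?thesis using assms by simp
next
  case False
  then have "\<bar>red2F3_coeff v a j\<bar> \<le> (\<bar>a\<bar> / (a + 1)) / fact j"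
    using red2F3_coeff_bound[OF assms] by simp
  also have "\<dots> \<le> (1 + \<bar>a\<bar> / (a + 1)) / fact j" by (intro divide_right_mono) auto
  finally show ?thesis .
qed

lemma red2F3_sums:
  assumes "v \<ge> 0" "a > -1"
  shows "(\<lambda>j. red2F3_coeff v a j * z ^ j) sums red2F3 v a z"
  unfolding red2F3_def
  by (intro summable_sums summable_power_series_fact_bound[OF red2F3_coeff_bound'] assms)

text \<open>Without its constant term 1 the series is dominated by |a| / (a + 1) times the
  exponential series without its constant term. This controls both small z and the limit a to
  0.\<close>

lemma abs_red2F3_minus_1_le:
  assumes "v \<ge> 0" "a > -1" "z \<ge> 0"
  shows "\<bar>red2F3 v a z - 1\<bar> \<le> \<bar>a\<bar> / (a + 1) * (exp z - 1)"
proof -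
  let ?K = "\<bar>a\<bar> / (a + 1)"
  have s: "(\<lambda>j. red2F3_coeff v a (Suc j) * z ^ Suc j) sums (red2F3 v a z - 1)"
    using sums_Suc_iff[of "\<lambda>j. red2F3_coeff v a j * z ^ j" "red2F3 v a z - 1"] red2F3_sums[OF assms(1,2), of z]
    by simp
  have e: "(\<lambda>j. ?K * (inverse (fact (Suc j)) * z ^ Suc j)) sums (?K * (exp z - 1))"
  proof (intro sums_mult)
    have "(\<lambda>j. inverse (fact j) * z ^ j) sums exp z"
      using exp_converges[of z] by (simp add: scaleR_conv_of_real)
    then show "(\<lambda>j. inverse (fact (Suc j)) * z ^ Suc j) sums (exp z - 1)"
      using sums_Suc_iff[of "\<lambda>j. inverse (fact j) * z ^ j" "exp z - 1"] by simp
  qed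
  have b: "norm (red2F3_coeff v a (Suc j) * z ^ Suc j) \<le> ?K * (inverse (fact (Suc j)) * z ^ Suc j)" for j
  proof -
    have "\<bar>red2F3_coeff v a (Suc j)\<bar> * z ^ Suc j \<le> ?K / fact (Suc j) * z ^ Suc j"
      using assms by (intro mult_right_mono red2F3_coeff_bound) auto
    then show ?thesis using assms(3) by (simp add: abs_mult field_simps)
  qed
  have sn: "summable (\<lambda>j. norm (red2F3_coeff v a (Suc j) * z ^ Suc j))"
    by (rule summable_comparison_test'[OF sums_summable[OF e], of 0])
      (use b in \<open>simp add: abs_mult del: power_Suc fact_Suc\<close>)
  have "\<bar>red2F3 v a z - 1\<bar> = norm (\<Sum>j. red2F3_coeff v a (Suc j) * z ^ Suc j)"
    using s by (simp add: sums_iff del: power_Suc)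
  also have "\<dots> \<le> (\<Sum>j. norm (red2F3_coeff v a (Suc j) * z ^ Suc j))"
    by (rule summable_norm[OF sn])
  also have "\<dots> \<le> (\<Sum>j. ?K * (inverse (fact (Suc j)) * z ^ Suc j))"
    by (rule suminf_le[OF b sn sums_summable[OF e]])
  also have "\<dots> = ?K * (exp z - 1)" using e by (simp add: sums_iff)
  finally show ?thesis .
qed

text \<open>Coefficientwise, (a + j) times the Pochhammer quotient is a, which is the identity a F +
  z F' = a G; it is then solved for F'.\<close>

lemma DERIV_red2F3:
  assumes "v \<ge> 0" "a > -1" "z > 0"
  shows "(red2F3 v a has_field_derivative a * (hyp1F2 v z - red2F3 v a z) / z) (at z)"
proof -
  let ?d = "\<Sum>j. diffs (red2F3_coeff v a) j * z ^ j"
  have D: "((\<lambda>z. \<Sum>j. red2F3_coeff v a j * z ^ j) has_field_derivative ?d) (at z)"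
    by (intro termdiffs_strong_converges_everywhere
        summable_power_series_fact_bound[OF red2F3_coeff_bound'] assms)
  have "summable (\<lambda>j. diffs (red2F3_coeff v a) j * z ^ j)"
    by (rule termdiff_converges_all)
      (intro summable_power_series_fact_bound[OF red2F3_coeff_bound'] assms)
  then have "(\<lambda>j. z * (diffs (red2F3_coeff v a) j * z ^ j)) sums (z * ?d)"
    by (intro sums_mult summable_sums)
  moreover have "z * (diffs (red2F3_coeff v a) j * z ^ j) =
      (\<lambda>j. real j * (red2F3_coeff v a j * z ^ j)) (Suc j)" for j
    by (simp add: diffs_def)
  ultimately have "(\<lambda>j. (\<lambda>j. real j * (red2F3_coeff v a j * z ^ j)) (Suc j)) sums (z * ?d)"
    by simp
  \<comment> \<open>The term of index 0 carries the factor 0, so undoing the shift adds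
    nothing.\<close>
  then have "(\<lambda>j. real j * (red2F3_coeff v a j * z ^ j)) sums (z * ?d)"
    by (subst (asm) sums_Suc_iff) simp
  then have "(\<lambda>j. a * (red2F3_coeff v a j * z ^ j) + real j * (red2F3_coeff v a j * z ^ j))
      sums (a * red2F3 v a z + z * ?d)"
    by (intro sums_add sums_mult red2F3_sums assms)
  moreover have "a * (red2F3_coeff v a j * z ^ j) + real j * (red2F3_coeff v a j * z ^ j)
      = a * (hyp1F2_coeff v j * z ^ j)" for j
  proof -
    have "a * (red2F3_coeff v a j * z ^ j) + real j * (red2F3_coeff v a j * z ^ j)
      = ((a + real j) * (pochhammer a j / pochhammer (a + 1) j)) * (hyp1F2_coeff v j * z ^ j)"
      unfolding red2F3_coeff_def by (simp only: distrib_right distrib_left mult_ac)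
    then show ?thesis by (simp only: pochhammer_ratio[OF assms(2)])
  qed
  ultimately have "(\<lambda>j. a * (hyp1F2_coeff v j * z ^ j)) sums (a * red2F3 v a z + z * ?d)" by simp
  moreover have "(\<lambda>j. a * (hyp1F2_coeff v j * z ^ j)) sums (a * hyp1F2 v z)"
    by (intro sums_mult hyp1F2_sums assms)
  ultimately have "a * red2F3 v a z + z * ?d = a * hyp1F2 v z" by (rule sums_unique2)
  then have "?d = a * (hyp1F2 v z - red2F3 v a z) / z" using assms(3) by (simp add: field_simps)
  with D show ?thesis by (simp add: red2F3_def[abs_def])
qed

text \<open>The function differentiated here has derivative \<open>a z powr (a - 1) * (hyp1F2 v z - c)\<close>.\<close>

lemma powr_red2F3_mono:
  assumes v: "v \<ge> 0" and a: "a > -1" and p: "0 < p" "p \<le> q"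
    and k: "\<And>z. p \<le> z \<Longrightarrow> z \<le> q \<Longrightarrow> a * (hyp1F2 v z - c) \<ge> 0"
  shows "p powr a * (red2F3 v a p - c) \<le> q powr a * (red2F3 v a q - c)"
proof (rule DERIV_nonneg_imp_nondecreasing[OF p(2)])
  fix x assume x: "p \<le> x" "x \<le> q"
  then have "x > 0" using p by simp
  have "((\<lambda>z. z powr a * (red2F3 v a z - c)) has_field_derivative
      a * x powr (a - 1) * (red2F3 v a x - c) + x powr a * (a * (hyp1F2 v x - red2F3 v a x) / x)) (at x)"
    using \<open>x > 0\<close> by (auto intro!: derivative_eq_intros DERIV_red2F3 v a)
  moreover have "a * x powr (a - 1) * (red2F3 v a x - c) + x powr a * (a * (hyp1F2 v x - red2F3 v a x) / x)
      = x powr (a - 1) * (a * (hyp1F2 v x - c))"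
  proof -
    have "x powr a = x powr (a - 1) * x" using \<open>x > 0\<close> by (simp add: powr_diff)
    then show ?thesis using \<open>x > 0\<close> by (simp add: field_simps)
  qed
  moreover have "x powr (a - 1) * (a * (hyp1F2 v x - c)) \<ge> 0"
    using k[OF x] by simp
  ultimately show "\<exists>d. ((\<lambda>z. z powr a * (red2F3 v a z - c)) has_field_derivative d) (at x) \<and> d \<ge> 0"
    by auto
qed

text \<open>Up to ln(3/2) the function stays within 1/2 of 1. From there on z^a F is nondecreasing,
  by G \<ge> 0 and the choice c = 0.\<close>

lemma red2F3_lower_pos:
  assumes v: "v \<ge> 1/2" and a: "a > 0" and z: "z > 0"
  shows "red2F3 v a z \<ge> 1/2 * (min 1 (ln (3/2) / z)) powr a"
proof -
  \<comment> \<open>Chosen so that \<open>exp ?u - 1\<close> is 1/2.\<close>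
  let ?u = "ln (3/2) :: real"
  have u: "?u > 0" by simp
  have small: "red2F3 v a x \<ge> 1/2" if "0 < x" "x \<le> ?u" for x
  proof -
    have "exp x \<le> 3/2" using that by (metis exp_le_cancel_iff exp_ln zero_less_divide_iff zero_less_numeral)
    have "\<bar>red2F3 v a x - 1\<bar> \<le> \<bar>a\<bar> / (a + 1) * (exp x - 1)"
      using v a that by (intro abs_red2F3_minus_1_le) auto
    also have "\<dots> \<le> 1 * (1/2)"
      using \<open>exp x \<le> 3/2\<close> a that by (intro mult_mono) auto
    finally show ?thesis by linarith
  qed
  show ?thesis
  proof (cases "z \<le> ?u")
    case True
    then have "min 1 (?u / z) = 1" using z by simp
    then show ?thesis using small[OF z True] by simp
  next
    case False
    then have m: "min 1 (?u / z) = ?u / z" using z by simp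
    have "?u powr a * (red2F3 v a ?u - 0) \<le> z powr a * (red2F3 v a z - 0)"
      using False a v less_le_trans[OF u]
      by (intro powr_red2F3_mono) (auto intro!: mult_nonneg_nonneg hyp1F2_bounds(1))
    moreover have "?u powr a * (1/2) \<le> ?u powr a * red2F3 v a ?u"
      using small[of ?u] u by (intro mult_left_mono) auto
    ultimately have "?u powr a * (1/2) \<le> z powr a * red2F3 v a z"
      unfolding diff_zero by (rule order_trans[rotated])
    then show ?thesis unfolding m using z u by (simp add: powr_divide field_simps)
  qed
qed

text \<open>For a \<le> 0 and c = 1 the bound G \<le> 1 makes z^a (F - 1) nondecreasing. Its limit
  from the right at 0 is 0, because F - 1 is O(z) and a + 1 > 0.\<close>

lemma red2F3_ge_1:
  assumes v: "v \<ge> 1/2" and a: "-1 < a" "a \<le> 0" and z: "z > 0"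
  shows "red2F3 v a z \<ge> 1"
proof -
  have "z powr a * (red2F3 v a z - 1) \<ge> 0"
  proof (rule tendsto_upperbound)
    have "((\<lambda>p. p powr (a + 1) * (\<bar>a\<bar> / (a + 1) * 2)) \<longlongrightarrow> 0 powr (a + 1) * (\<bar>a\<bar> / (a + 1) * 2)) (at_right 0)"
      using a by (intro tendsto_mult tendsto_powr' tendsto_const tendsto_ident_at) (auto simp: eventually_at_right_less intro!: eventually_at_rightI[of 0 1])
    then have "((\<lambda>p. p powr (a + 1) * (\<bar>a\<bar> / (a + 1) * 2)) \<longlongrightarrow> 0) (at_right 0)" by simp
    moreover have "\<forall>\<^sub>F p in at_right 0. norm (p powr a * (red2F3 v a p - 1)) \<le> p powr (a + 1) * (\<bar>a\<bar> / (a + 1) * 2)"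
    proof -
      have "norm (p powr a * (red2F3 v a p - 1)) \<le> p powr (a + 1) * (\<bar>a\<bar> / (a + 1) * 2)"
        if p: "0 < p" "p < 1" for p
      proof -
        have "p\<^sup>2 \<le> p" using p by (simp add: power2_eq_square)
        then have "exp p - 1 \<le> 2 * p" using exp_bound[of p] p by simp
        then have "\<bar>a\<bar> / (a + 1) * (exp p - 1) \<le> \<bar>a\<bar> / (a + 1) * (2 * p)"
          using a by (intro mult_left_mono divide_nonneg_pos) auto
        moreover have "\<bar>red2F3 v a p - 1\<bar> \<le> \<bar>a\<bar> / (a + 1) * (exp p - 1)"
          using v a p by (intro abs_red2F3_minus_1_le) auto
        ultimately have "\<bar>red2F3 v a p - 1\<bar> \<le> \<bar>a\<bar> / (a + 1) * (2 * p)" by linarith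
        then have "p powr a * \<bar>red2F3 v a p - 1\<bar> \<le> p powr a * (\<bar>a\<bar> / (a + 1) * (2 * p))"
          by (intro mult_left_mono) auto
        also have "\<dots> = p powr (a + 1) * (\<bar>a\<bar> / (a + 1) * 2)"
          using p by (simp add: powr_add)
        finally show ?thesis by (simp add: abs_mult)
      qed
      then show ?thesis
        by (intro eventually_at_right_less[THEN eventually_mono] eventually_at_rightI[of 0 1]) auto
    qed
    ultimately show "((\<lambda>p. p powr a * (red2F3 v a p - 1)) \<longlongrightarrow> 0) (at_right 0)"
      by (rule Lim_null_comparison[rotated])
    show "\<forall>\<^sub>F p in at_right 0. p powr a * (red2F3 v a p - 1) \<le> z powr a * (red2F3 v a z - 1)"
    proof (rule eventually_at_rightI[of 0 z])
      fix p assume "p \<in> {0<..<z}"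
      then show "p powr a * (red2F3 v a p - 1) \<le> z powr a * (red2F3 v a z - 1)"
        using v a by (intro powr_red2F3_mono) (auto intro!: mult_nonpos_nonpos simp: hyp1F2_bounds(2))
    qed (use z in auto)
  qed auto
  then show ?thesis using z by (simp add: zero_le_mult_iff)
qed

text \<open>At 4 v the bound G \<le> 1/2 sets in, so c = 1/2 is admissible from there on, and F(4 v)
  - 1/2 \<ge> 1/2 by \<open>red2F3_ge_1\<close>. The growth z^(-a) carries the additional smoothing
  for \<beta> > n + 2.\<close>

lemma red2F3_lower_neg:
  assumes v: "v \<ge> 1/2" and a: "-1 < a" "a \<le> 0" and z: "z \<ge> 4 * v"
  shows "red2F3 v a z \<ge> 1/2 * (z / (4 * v)) powr (- a)"
proof -
  have p: "4 * v > 0" "z > 0" using v z by auto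
  have "(4 * v) powr a * (red2F3 v a (4 * v) - 1/2) \<le> z powr a * (red2F3 v a z - 1/2)"
    using v a z p
    by (intro powr_red2F3_mono) (auto intro!: mult_nonpos_nonpos hyp1F2_bounds(3)[THEN diff_le_0_iff_le[THEN iffD2]])
  moreover have "(4 * v) powr a * (1/2) \<le> (4 * v) powr a * (red2F3 v a (4 * v) - 1/2)"
    using red2F3_ge_1[OF v a p(1)] by (intro mult_left_mono) auto
  ultimately have "(4 * v) powr a * (1/2) \<le> z powr a * (red2F3 v a z - 1/2)" by linarith
  also have "\<dots> \<le> z powr a * red2F3 v a z" by (intro mult_left_mono) auto
  finally show ?thesis using p by (simp add: powr_divide powr_minus field_simps)
qed

section \<open>Test functions and trigonometric series\<close>

lemma has_vector_derivative_along_line: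
  fixes f :: "real^'n \<Rightarrow> complex"
  assumes "(f has_derivative D) (at (x + h *\<^sub>R v))"
  shows "((\<lambda>h. f (x + h *\<^sub>R v)) has_vector_derivative D v) (at h)"
proof -
  have "((\<lambda>h. x + h *\<^sub>R v) has_derivative (\<lambda>s. s *\<^sub>R v)) (at h)"
    by (auto intro!: derivative_eq_intros)
  from has_derivative_compose[OF this assms]
  have "((\<lambda>h. f (x + h *\<^sub>R v)) has_derivative (\<lambda>s. D (s *\<^sub>R v))) (at h)" .
  moreover have "D (s *\<^sub>R v) = s *\<^sub>R D v" for s
    using assms by (simp add: has_derivative_linear linear_cmul)
  ultimately show ?thesis by (simp add: has_vector_derivative_def)
qed

lemma partial_deriv_eq:
  assumes "(f has_derivative D) (at x)"
  shows "partial_deriv i f x = D (axis i 1)"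
  unfolding partial_deriv_def
  using has_vector_derivative_along_line[of f D x 0 "axis i 1"] assms
  by (simp add: vector_derivative_at)

lemma partial_deriv_has_vector_derivative:
  assumes "f differentiable_on UNIV"
  shows "((\<lambda>h. f (x + h *\<^sub>R axis i 1)) has_vector_derivative
    partial_deriv i f (x + h *\<^sub>R axis i 1)) (at h)"
proof -
  obtain D where D: "(f has_derivative D) (at (x + h *\<^sub>R axis i 1))"
    using assms unfolding differentiable_on_def differentiable_def by auto
  show ?thesis
    using has_vector_derivative_along_line[OF D] partial_deriv_eq[OF D] by simp
qed

lemma partial_deriv_add:
  assumes "f differentiable_on UNIV" "g differentiable_on UNIV"
  shows "partial_deriv i (\<lambda>x. f x + g x) = (\<lambda>x. partial_deriv i f x + partial_deriv i g x)"
proof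
  fix x
  obtain D E where D: "(f has_derivative D) (at x)" and E: "(g has_derivative E) (at x)"
    using assms unfolding differentiable_on_def differentiable_def by fastforce
  show "partial_deriv i (\<lambda>x. f x + g x) x = partial_deriv i f x + partial_deriv i g x"
    using partial_deriv_eq[OF has_derivative_add[OF D E]] partial_deriv_eq[OF D] partial_deriv_eq[OF E]
    by simp
qed

lemma partial_deriv_mult:
  assumes "f differentiable_on UNIV" "g differentiable_on UNIV"
  shows "partial_deriv i (\<lambda>x. f x * g x) = (\<lambda>x. f x * partial_deriv i g x + partial_deriv i f x * g x)"
proof
  fix x
  obtain D E where D: "(f has_derivative D) (at x)" and E: "(g has_derivative E) (at x)"
    using assms unfolding differentiable_on_def differentiable_def by fastforce
  show "partial_deriv i (\<lambda>x. f x * g x) x = f x * partial_deriv i g x + partial_deriv i f x * g x"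
    using partial_deriv_eq[OF has_derivative_mult[OF D E]] partial_deriv_eq[OF D] partial_deriv_eq[OF E]
    by simp
qed

lemma partial_deriv_const: "partial_deriv i (\<lambda>x. c) = (\<lambda>x. 0)"
  using partial_deriv_eq[OF has_derivative_const] by blast

lemma partial_deriv_cmult:
  assumes "f differentiable_on UNIV"
  shows "partial_deriv i (\<lambda>x. c * f x) = (\<lambda>x. c * partial_deriv i f x)"
  using partial_deriv_mult[of "\<lambda>x. c" f i] assms by (simp add: partial_deriv_const)

lemma iterated_partial_Nil [simp]: "iterated_partial [] f = f"
  by (simp add: iterated_partial_def)

lemma iterated_partial_Cons:
  "iterated_partial (j # js) f = partial_deriv j (iterated_partial js f)"
  by (simp add: iterated_partial_def)

lemma iterated_partial_append:
  "iterated_partial (is @ js) f = iterated_partial is (iterated_partial js f)"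
  by (simp add: iterated_partial_def)

lemma test_function_differentiable:
  "\<phi> \<in> test_functions \<Longrightarrow> iterated_partial js \<phi> differentiable_on UNIV"
  by (simp add: test_functions_def)

lemma test_function_differentiable':
  "\<phi> \<in> test_functions \<Longrightarrow> \<phi> differentiable_on UNIV"
  using test_function_differentiable[of \<phi> "[]"] by simp

lemma test_function_continuous:
  "\<phi> \<in> test_functions \<Longrightarrow> continuous_on S \<phi>"
  using test_function_differentiable'[THEN differentiable_imp_continuous_on]
  by (rule continuous_on_subset) auto

lemma test_function_periodic:
  "\<phi> \<in> test_functions \<Longrightarrow> \<phi> (x + (2 * pi) *\<^sub>R lattice_vec k) = \<phi> x"
  by (simp add: test_functions_def)

lemma test_function_partial:
  assumes "\<phi> \<in> test_functions"
  shows "partial_deriv i \<phi> \<in> test_functions"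
proof -
  have "iterated_partial js (partial_deriv i \<phi>) differentiable_on UNIV" for js
    using test_function_differentiable[OF assms, of "js @ [i]"]
    by (simp add: iterated_partial_append iterated_partial_Cons)
  moreover have "partial_deriv i \<phi> (x + (2 * pi) *\<^sub>R lattice_vec k) = partial_deriv i \<phi> x" for k x
  proof -
    have "(\<lambda>h. \<phi> (x + (2 * pi) *\<^sub>R lattice_vec k + h *\<^sub>R axis i 1)) = (\<lambda>h. \<phi> (x + h *\<^sub>R axis i 1))"
      using test_function_periodic[OF assms, of "x + _ *\<^sub>R axis i 1" k]
      by (simp add: add_ac)
    then show ?thesis by (simp add: partial_deriv_def)
  qed
  ultimately show ?thesis by (simp add: test_functions_def)
qed

lemma test_function_iterated_partial:
  "\<phi> \<in> test_functions \<Longrightarrow> iterated_partial js \<phi> \<in> test_functions"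
  by (induction js) (auto simp: iterated_partial_Cons intro: test_function_partial)

lemma iterated_partial_add:
  assumes "\<phi> \<in> test_functions" "\<psi> \<in> test_functions"
  shows "iterated_partial js (\<lambda>x. \<phi> x + \<psi> x) =
    (\<lambda>x. iterated_partial js \<phi> x + iterated_partial js \<psi> x)"
  by (induction js)
    (simp_all add: iterated_partial_Cons partial_deriv_add assms test_function_differentiable)

lemma iterated_partial_cmult:
  assumes "\<phi> \<in> test_functions"
  shows "iterated_partial js (\<lambda>x. c * \<phi> x) = (\<lambda>x. c * iterated_partial js \<phi> x)"
  by (induction js)
    (simp_all add: iterated_partial_Cons partial_deriv_cmult assms test_function_differentiable)

lemma iterated_partial_zero: "iterated_partial js (\<lambda>x. 0) = (\<lambda>x. 0)"
  by (induction js) (simp_all add: iterated_partial_Cons partial_deriv_const)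

lemma test_function_add:
  assumes "\<phi> \<in> test_functions" "\<psi> \<in> test_functions"
  shows "(\<lambda>x. \<phi> x + \<psi> x) \<in> test_functions"
  using assms iterated_partial_add[OF assms]
  by (auto simp: test_functions_def intro!: differentiable_on_add)

lemma test_function_cmult:
  assumes "\<phi> \<in> test_functions"
  shows "(\<lambda>x. c * \<phi> x) \<in> test_functions"
  using assms iterated_partial_cmult[OF assms]
  by (auto simp: test_functions_def intro!: differentiable_on_mult)

lemma test_function_zero: "(\<lambda>x. 0) \<in> test_functions"
  by (simp add: test_functions_def iterated_partial_zero)

lemma test_function_sum:
  assumes "finite I" "\<And>i. i \<in> I \<Longrightarrow> f i \<in> test_functions"
  shows "(\<lambda>x. \<Sum>i\<in>I. f i x) \<in> test_functions \<and>
    (\<forall>js. iterated_partial js (\<lambda>x. \<Sum>i\<in>I. f i x) = (\<lambda>x. \<Sum>i\<in>I. iterated_partial js (f i) x))"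
  using assms
proof (induction I)
  case empty
  then show ?case by (simp add: test_function_zero iterated_partial_zero)
next
  case (insert i I)
  then show ?case by (simp add: test_function_add iterated_partial_add)
qed

section \<open>Suprema over a period and the norms of order N\<close>

lemma in_torus_translate: "\<exists>k. x + (2 * pi) *\<^sub>R lattice_vec k \<in> torus"
proof
  let ?k = "\<chi> i. - \<lfloor>x $ i / (2 * pi)\<rfloor>"
  have "0 \<le> x $ i + 2 * pi * real_of_int (- \<lfloor>x $ i / (2 * pi)\<rfloor>) \<and>
      x $ i + 2 * pi * real_of_int (- \<lfloor>x $ i / (2 * pi)\<rfloor>) \<le> 2 * pi" for i
  proof -
    define y where "y = x $ i / (2 * pi)"
    have x: "x $ i = 2 * pi * y" by (simp add: y_def)
    have "2 * pi * real_of_int \<lfloor>y\<rfloor> \<le> 2 * pi * y" "2 * pi * y \<le> 2 * pi * (real_of_int \<lfloor>y\<rfloor> + 1)"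
      by (rule mult_left_mono; simp; linarith)+
    then show ?thesis
      unfolding y_def[symmetric] by (simp add: x algebra_simps)
  qed
  then show "x + (2 * pi) *\<^sub>R lattice_vec ?k \<in> torus"
    by (simp add: torus_def lattice_vec_def mem_box_cart)
qed

text \<open>By periodicity the range is contained in the image of the compact torus. Boundedness is
  what gives the suprema in \<open>Ck_norm\<close> their meaning.\<close>

lemma test_function_bounded:
  fixes \<phi> :: "real^'n \<Rightarrow> complex"
  assumes "\<phi> \<in> test_functions"
  shows "bdd_above (range (\<lambda>x. cmod (\<phi> x)))"
proof -
  have "compact ((\<lambda>x. cmod (\<phi> x)) ` torus)"
    unfolding torus_def
    by (intro compact_continuous_image continuous_intros test_function_continuous assms compact_cbox)
  moreover have "range (\<lambda>x. cmod (\<phi> x)) \<subseteq> (\<lambda>x. cmod (\<phi> x)) ` torus"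
  proof clarify
    fix x :: "real^'n"
    obtain k where "x + (2 * pi) *\<^sub>R lattice_vec k \<in> torus" using in_torus_translate by blast
    then show "cmod (\<phi> x) \<in> (\<lambda>x. cmod (\<phi> x)) ` torus"
      using test_function_periodic[OF assms, of x k] by (metis imageI)
  qed
  ultimately show ?thesis
    by (meson bdd_above_mono compact_imp_bounded bounded_imp_bdd_above)
qed

lemma cmod_le_SUP:
  "\<phi> \<in> test_functions \<Longrightarrow> cmod (\<phi> x) \<le> (SUP x. cmod (\<phi> x))"
  by (rule cSUP_upper) (auto intro: test_function_bounded)

lemma SUP_cmod_nonneg:
  "\<phi> \<in> test_functions \<Longrightarrow> 0 \<le> (SUP x. cmod (\<phi> x))"
  using cmod_le_SUP[of \<phi> 0] norm_ge_zero by (rule order_trans[rotated])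

lemma finite_bounded_lists: "finite {js :: 'n::finite list. length js \<le> N}"
  using finite_lists_length_le[of "UNIV :: 'n set" N] by simp

lemma cmod_le_Ck_norm:
  assumes "\<phi> \<in> test_functions"
  shows "cmod (\<phi> x) \<le> Ck_norm N \<phi>"
proof -
  have "cmod (iterated_partial [] \<phi> x) \<le> (SUP x. cmod (iterated_partial [] \<phi> x))"
    using assms by (intro cmod_le_SUP) simp
  also have "\<dots> \<le> Ck_norm N \<phi>"
    unfolding Ck_norm_def
    by (rule member_le_sum) (auto intro!: SUP_cmod_nonneg test_function_iterated_partial assms finite_bounded_lists)
  finally show ?thesis by simp
qed

lemma Ck_norm_nonneg: "\<phi> \<in> test_functions \<Longrightarrow> 0 \<le> Ck_norm N \<phi>"
  unfolding Ck_norm_def by (intro sum_nonneg SUP_cmod_nonneg test_function_iterated_partial)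

lemma Ck_norm_mono:
  assumes "\<phi> \<in> test_functions" "M \<le> N"
  shows "Ck_norm M \<phi> \<le> Ck_norm N \<phi>"
  unfolding Ck_norm_def
  by (intro sum_mono2 finite_bounded_lists)
    (use assms in \<open>auto intro!: SUP_cmod_nonneg test_function_iterated_partial\<close>)

text \<open>The innermost derivative is the last entry of an index list, so appending i embeds the
  lists of length at most N into those of length at most \<open>Suc N\<close>.\<close>

lemma Ck_norm_partial:
  assumes "\<phi> \<in> test_functions"
  shows "Ck_norm N (partial_deriv i \<phi>) \<le> Ck_norm (Suc N) \<phi>"
proof -
  have "Ck_norm N (partial_deriv i \<phi>) =
      (\<Sum>js | length js \<le> N. SUP x. cmod (iterated_partial (js @ [i]) \<phi> x))"
    by (simp add: Ck_norm_def iterated_partial_append iterated_partial_Cons)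
  also have "\<dots> = (\<Sum>js \<in> (\<lambda>js. js @ [i]) ` {js. length js \<le> N}. SUP x. cmod (iterated_partial js \<phi> x))"
    by (subst sum.reindex) (auto simp: inj_on_def)
  also have "\<dots> \<le> Ck_norm (Suc N) \<phi>"
    unfolding Ck_norm_def
    by (intro sum_mono2 finite_bounded_lists)
      (auto intro!: SUP_cmod_nonneg test_function_iterated_partial assms)
  finally show ?thesis .
qed

lemma Ck_norm_sum:
  assumes "finite I" "\<And>i. i \<in> I \<Longrightarrow> f i \<in> test_functions"
  shows "Ck_norm N (\<lambda>x. \<Sum>i\<in>I. f i x) \<le> (\<Sum>i\<in>I. Ck_norm N (f i))"
proof -
  have "Ck_norm N (\<lambda>x. \<Sum>i\<in>I. f i x) =
      (\<Sum>js | length js \<le> N. SUP x. cmod (\<Sum>i\<in>I. iterated_partial js (f i) x))"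
    using test_function_sum[of I f] assms by (simp add: Ck_norm_def)
  also have "\<dots> \<le> (\<Sum>js | length js \<le> N. \<Sum>i\<in>I. SUP x. cmod (iterated_partial js (f i) x))"
  proof (intro sum_mono cSUP_least)
    fix js x
    have "cmod (\<Sum>i\<in>I. iterated_partial js (f i) x) \<le> (\<Sum>i\<in>I. cmod (iterated_partial js (f i) x))"
      by (rule norm_sum)
    also have "\<dots> \<le> (\<Sum>i\<in>I. SUP x. cmod (iterated_partial js (f i) x))"
      by (intro sum_mono cmod_le_SUP test_function_iterated_partial assms)
    finally show "cmod (\<Sum>i\<in>I. iterated_partial js (f i) x) \<le> \<dots>" .
  qed auto
  also have "\<dots> = (\<Sum>i\<in>I. Ck_norm N (f i))"
    unfolding Ck_norm_def by (rule sum.swap)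
  finally show ?thesis .
qed

section \<open>Characters\<close>

lemma character_has_derivative:
  "(character k has_derivative (\<lambda>v. \<i> * complex_of_real (lattice_vec k \<bullet> v) * character k x)) (at x)"
proof -
  have "((\<lambda>x. \<i> * complex_of_real (lattice_vec k \<bullet> x)) has_derivative
      (\<lambda>v. \<i> * complex_of_real (lattice_vec k \<bullet> v))) (at x)"
    by (intro has_derivative_mult_right has_derivative_of_real has_derivative_inner_right has_derivative_ident)
  from has_derivative_compose[OF this DERIV_exp[unfolded has_field_derivative_def]]
  show ?thesis unfolding character_def[abs_def] by (simp add: mult_ac)
qed

lemma character_differentiable: "character k differentiable_on UNIV"
  using character_has_derivative[of k] by (auto simp: differentiable_on_def differentiable_def)

lemma partial_deriv_character:
  "partial_deriv i (character k) = (\<lambda>x. \<i> * of_int (k $ i) * character k x)"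
  by (rule ext) (simp add: partial_deriv_eq[OF character_has_derivative] inner_axis lattice_vec_def)

lemma character_periodic: "character k (x + (2 * pi) *\<^sub>R lattice_vec l) = character k x"
proof -
  have "lattice_vec k \<bullet> lattice_vec l = real_of_int (\<Sum>i\<in>UNIV. k $ i * l $ i)"
    by (simp add: inner_vec_def lattice_vec_def)
  then obtain m :: int where m: "lattice_vec k \<bullet> lattice_vec l = real_of_int m" by blast
  have "\<i> * complex_of_real (lattice_vec k \<bullet> (x + (2 * pi) *\<^sub>R lattice_vec l)) =
      \<i> * complex_of_real (lattice_vec k \<bullet> x) + 2 * of_int m * pi * \<i>"
    by (simp add: inner_add_right m algebra_simps)
  moreover have "exp (2 * of_int m * pi * \<i>) = 1"
    using exp_integer_2pi[of "of_int m"] by simp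
  ultimately show ?thesis by (simp add: character_def exp_add)
qed

text \<open>Characters are eigenfunctions of each partial derivative, so every iterated derivative
  is a multiple of the character.\<close>

lemma character_test_function: "character k \<in> test_functions"
proof -
  have "\<exists>c. iterated_partial js (character k) = (\<lambda>x. c * character k x)" for js
  proof (induction js)
    case Nil
    show ?case by (intro exI[of _ 1]) simp
  next
    case (Cons j js)
    then obtain c where c: "iterated_partial js (character k) = (\<lambda>x. c * character k x)" ..
    show ?case
      by (intro exI[of _ "c * (\<i> * of_int (k $ j))"])
        (simp add: iterated_partial_Cons c partial_deriv_cmult character_differentiable partial_deriv_character mult.assoc)
  qed
  then have "iterated_partial js (character k) differentiable_on UNIV" for js
    using differentiable_on_mult[OF differentiable_on_const character_differentiable[of k]]
    by metis
  then show ?thesis by (simp add: test_functions_def character_periodic)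
qed

lemma character_mult: "character k x * character l x = character (k + l) x"
proof -
  have "lattice_vec (k + l) = lattice_vec k + lattice_vec l" by (simp add: lattice_vec_def vec_eq_iff)
  then show ?thesis by (simp add: character_def mult_exp_exp inner_add_left distrib_left)
qed

lemma lattice_vec_0 [simp]: "lattice_vec 0 = 0"
  by (simp add: lattice_vec_def vec_eq_iff)

lemma character_0 [simp]: "character 0 x = 1"
  by (simp add: character_def)

lemma cmod_character [simp]: "cmod (character k x) = 1"
  by (simp add: character_def norm_exp_i_times)

lemma lattice_vec_axis: "lattice_vec (axis i m) = axis i (real_of_int m)"
  by (auto simp: lattice_vec_def axis_def vec_eq_iff)

section \<open>Integration by parts on the torus and decay of Fourier integrals\<close>

text \<open>The shifted box is cut at x_i = 2 pi. Moved back by one period, the part beyond the cut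
  fills the slab 0 \<le> x_i \<le> h that the shift left empty.\<close>

lemma integral_torus_translate:
  fixes f :: "real^'n \<Rightarrow> complex"
  assumes cont: "continuous_on UNIV f"
    and per: "\<And>x. f (x + axis i (2 * pi)) = f x"
    and h: "0 \<le> h" "h \<le> 2 * pi"
  shows "integral torus (\<lambda>x. f (x + axis i h)) = integral torus f"
proof -
  define T :: "real^'n" where "T = (\<chi> i. 2 * pi)"
  define E :: "real \<Rightarrow> real^'n" where "E = axis i"
  have int: "f integrable_on cbox a b" for a b
    by (intro integrable_continuous continuous_on_subset[OF cont]) auto
  have B: "axis i 1 \<in> (Basis :: (real^'n) set)" by (auto simp: Basis_vec_def)
  have inner: "x \<bullet> axis i 1 = x $ i" for x :: "real^'n" by (simp add: inner_axis)
  have mem: "x \<in> cbox a b \<longleftrightarrow> a $ i \<le> x $ i \<and> x $ i \<le> b $ i \<and> (\<forall>j. j \<noteq> i \<longrightarrow> a $ j \<le> x $ j \<and> x $ j \<le> b $ j)"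
    for a b x :: "real^'n"
    unfolding mem_box_cart by metis
  have E: "E c $ j = (if j = i then c else 0)" for c j by (auto simp: E_def axis_def)
  have "integral torus (\<lambda>x. f (x + E h)) = integral (cbox (0 + E h) (T + E h)) f"
    using integral_shift_cbox[of "0 + E h" "E h" "T + E h" f] by (simp add: torus_def T_def)
  also have "\<dots> = integral (cbox (0 + E h) (T + E h) \<inter> {x. x \<bullet> axis i 1 \<le> 2 * pi}) f +
      integral (cbox (0 + E h) (T + E h) \<inter> {x. x \<bullet> axis i 1 \<ge> 2 * pi}) f"
    by (rule integral_split[OF int B])
  also have "cbox (0 + E h) (T + E h) \<inter> {x. x \<bullet> axis i 1 \<le> 2 * pi} = cbox (E h) T"
    using h by (auto simp: mem inner E T_def)
  also have "cbox (0 + E h) (T + E h) \<inter> {x. x \<bullet> axis i 1 \<ge> 2 * pi} =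
      cbox (E (2 * pi)) (T + E h)"
    using h by (auto simp: mem inner E T_def)
  also have "integral (cbox (E (2 * pi)) (T + E h)) f =
      integral (cbox (E (2 * pi) - E (2 * pi)) (T + E h - E (2 * pi))) (\<lambda>x. f (x + E (2 * pi)))"
    by (rule integral_shift_cbox[symmetric])
  also have "\<dots> = integral (cbox 0 (T + E h - E (2 * pi))) f"
    by (simp add: E_def per)
  also have "cbox 0 (T + E h - E (2 * pi)) = cbox 0 T \<inter> {x. x \<bullet> axis i 1 \<le> h}"
    using h by (auto simp: mem inner E T_def)
  also have "cbox (E h) T = cbox 0 T \<inter> {x. x \<bullet> axis i 1 \<ge> h}"
    using h by (auto simp: mem inner E T_def)
  also have "integral (cbox 0 T \<inter> {x. x \<bullet> axis i 1 \<ge> h}) f + integral (cbox 0 T \<inter> {x. x \<bullet> axis i 1 \<le> h}) f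
      = integral (cbox 0 T) f"
    using integral_split[OF int[of 0 T] B, of h] by simp
  finally show ?thesis by (simp add: E_def torus_def T_def)
qed

text \<open>The integral is constant under translation in direction \<open>i\<close>; differentiate under the integral sign.\<close>

lemma integral_partial_deriv_eq_0:
  fixes f :: "real^'n \<Rightarrow> complex"
  assumes f: "f differentiable_on UNIV"
    and cont: "continuous_on UNIV (partial_deriv i f)"
    and per: "\<And>x. f (x + axis i (2 * pi)) = f x"
  shows "integral torus (partial_deriv i f) = 0"
proof -
  have ax: "h *\<^sub>R axis i 1 = axis i h" for h :: real
    by (simp add: axis_def vec_eq_iff)
  have fc: "continuous_on UNIV f" by (rule differentiable_imp_continuous_on[OF f])
  \<comment> \<open>The translation lemma covers these h, so the derivative at 0 is taken within
    this interval.\<close>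
  let ?U = "{0..2 * pi}"
  have "((\<lambda>h. integral torus (\<lambda>x. f (x + axis i h))) has_vector_derivative
      integral torus (\<lambda>x. partial_deriv i f (x + axis i 0))) (at 0 within ?U)"
    unfolding torus_def
  proof (rule leibniz_rule_vector_derivative)
    show "((\<lambda>h. f (x + axis i h)) has_vector_derivative partial_deriv i f (x + axis i h)) (at h within ?U)" for h x
      using partial_deriv_has_vector_derivative[OF f, of x i h, THEN has_vector_derivative_at_within]
      by (simp add: ax)
    show "(\<lambda>x. f (x + axis i h)) integrable_on cbox 0 (\<chi> i. 2 * pi)" for h
      by (intro integrable_continuous continuous_on_compose2[OF fc] continuous_intros) auto
    have "continuous_on (?U \<times> cbox 0 (\<chi> i. 2 * pi)) (\<lambda>p. partial_deriv i f (snd p + fst p *\<^sub>R axis i 1))"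
      by (intro continuous_on_compose2[OF cont] continuous_intros) auto
    then show "continuous_on (?U \<times> cbox 0 (\<chi> i. 2 * pi)) (\<lambda>(h, x). partial_deriv i f (x + axis i h))"
      by (simp add: case_prod_unfold ax)
  qed auto
  moreover have "((\<lambda>h. integral torus (\<lambda>x. f (x + axis i h))) has_vector_derivative 0) (at 0 within ?U)"
    by (rule has_vector_derivative_transform[OF _ _ has_vector_derivative_const[of "integral torus f"]])
      (auto simp: integral_torus_translate[OF fc per])
  ultimately have "integral torus (\<lambda>x. partial_deriv i f (x + axis i 0)) = 0"
    by (rule vector_derivative_unique_within[rotated]) (simp add: trivial_limit_within islimpt_greaterThanLessThan1 islimpt_Icc)
  then show ?thesis by (simp add: axis_def zero_vec_def[symmetric])
qed

lemma character_times_integrable: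
  assumes "\<phi> \<in> test_functions"
  shows "(\<lambda>x. character k x * \<phi> x) integrable_on torus"
  unfolding torus_def
  by (intro integrable_continuous continuous_intros test_function_continuous character_test_function assms)

text \<open>Integration by parts without boundary terms: the product with the character is periodic,
  so its partial derivative integrates to 0.\<close>

lemma integral_character_partial_deriv:
  assumes "\<phi> \<in> test_functions"
  shows "integral torus (\<lambda>x. character k x * partial_deriv i \<phi> x) =
    - (\<i> * of_int (k $ i)) * integral torus (\<lambda>x. character k x * \<phi> x)"
proof -
  have "partial_deriv i (\<lambda>x. character k x * \<phi> x) =
      (\<lambda>x. character k x * partial_deriv i \<phi> x + (\<i> * of_int (k $ i)) * (character k x * \<phi> x))"
    using assms
    by (simp add: partial_deriv_mult character_differentiable test_function_differentiable'
        partial_deriv_character mult.assoc)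
  moreover have "integral torus (partial_deriv i (\<lambda>x. character k x * \<phi> x)) = 0"
  proof (rule integral_partial_deriv_eq_0)
    show "continuous_on UNIV (partial_deriv i (\<lambda>x. character k x * \<phi> x))"
      unfolding calculation
      by (intro continuous_intros test_function_continuous character_test_function test_function_partial assms)
    show "character k (x + axis i (2 * pi)) * \<phi> (x + axis i (2 * pi)) = character k x * \<phi> x" for x
    proof -
      have "axis i (2 * pi) = (2 * pi) *\<^sub>R lattice_vec (axis i 1)"
        by (simp add: lattice_vec_axis) (simp add: axis_def vec_eq_iff)
      then show ?thesis
        by (simp only: character_periodic test_function_periodic[OF assms])
    qed
  qed (intro differentiable_on_mult character_differentiable test_function_differentiable' assms)
  moreover have "integral torus (\<lambda>x. character k x * partial_deriv i \<phi> x + (\<i> * of_int (k $ i)) * (character k x * \<phi> x)) =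
      integral torus (\<lambda>x. character k x * partial_deriv i \<phi> x) +
      (\<i> * of_int (k $ i)) * integral torus (\<lambda>x. character k x * \<phi> x)"
    by (subst Henstock_Kurzweil_Integration.integral_add)
      (auto intro!: character_times_integrable test_function_partial integrable_on_mult_right assms)
  ultimately show ?thesis by (simp add: algebra_simps add_eq_0_iff2)
qed

lemma content_torus: "measure lborel (torus :: (real^'n) set) = (2 * pi) ^ CARD('n)"
proof -
  have "cbox 0 (\<chi> i. 2 * pi) \<noteq> ({} :: (real^'n) set)"
    by (auto simp: cbox_interval less_eq_vec_def)
  then show ?thesis unfolding torus_def by (subst content_cbox_cart) auto
qed

text \<open>For k \<noteq> 0, integration by parts against the constant function
  \<open>character 0\<close>, whose derivative vanishes, in a direction where k has a nonzero
  entry.\<close>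

lemma integral_character:
  "integral torus (character k) = (if k = 0 then complex_of_real ((2 * pi) ^ CARD('n)) else 0)"
  for k :: "int^'n"
proof (cases "k = 0")
  case True
  have "integral (torus :: (real^'n) set) (\<lambda>x. 1 :: complex) = measure lborel (torus :: (real^'n) set) *\<^sub>R 1"
    unfolding torus_def by (rule integral_const)
  moreover have "character (0 :: int^'n) = (\<lambda>x. 1)" by (rule ext) simp
  ultimately show ?thesis using True by (simp add: content_torus scaleR_conv_of_real)
next
  case False
  then obtain i where i: "k $ i \<noteq> 0" by (auto simp: vec_eq_iff)
  have "integral torus (\<lambda>x. character k x * partial_deriv i (character 0) x) =
      - (\<i> * of_int (k $ i)) * integral torus (\<lambda>x. character k x * character 0 x)"
    by (rule integral_character_partial_deriv[OF character_test_function])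
  then have "integral torus (\<lambda>x. character k x) = 0"
    using i by (simp add: partial_deriv_character)
  then show ?thesis using False by simp
qed

text \<open>Each further power on the left costs one derivative: the modulus of \<open>k $ i\<close>
  is absorbed by \<open>partial_deriv i\<close>, and the factor 1 + n counts the summand 1 together
  with the n directions.\<close>

lemma cmod_integral_character_le:
  fixes \<phi> :: "real^'n \<Rightarrow> complex"
  assumes "\<phi> \<in> test_functions"
  shows "(1 + (\<Sum>i\<in>UNIV. \<bar>real_of_int (k $ i)\<bar>)) ^ N * cmod (integral torus (\<lambda>x. character k x * \<phi> x))
    \<le> (2 * pi) ^ CARD('n) * (1 + real CARD('n)) ^ N * Ck_norm N \<phi>"
  using assms
proof (induction N arbitrary: \<phi>)
  case 0
  have "norm (integral torus (\<lambda>x. character k x * \<phi> x)) \<le> Ck_norm 0 \<phi> * measure lborel (torus :: (real^'n) set)"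
    unfolding torus_def
  proof (rule has_integral_bound)
    show "0 \<le> Ck_norm 0 \<phi>" by (rule Ck_norm_nonneg[OF 0])
    show "((\<lambda>x. character k x * \<phi> x) has_integral
        integral (cbox 0 (\<chi> i. 2 * pi)) (\<lambda>x. character k x * \<phi> x)) (cbox 0 (\<chi> i. 2 * pi))"
      using character_times_integrable[OF 0] by (simp add: torus_def integrable_integral)
    show "norm (character k x * \<phi> x) \<le> Ck_norm 0 \<phi>" for x
      using cmod_le_Ck_norm[OF 0, of x 0] by (simp add: norm_mult)
  qed
  then show ?case by (simp add: content_torus mult.commute)
next
  case (Suc N)
  let ?I = "\<lambda>\<phi>. cmod (integral torus (\<lambda>x. character k x * \<phi> x))"
  let ?A = "1 + (\<Sum>i\<in>UNIV. \<bar>real_of_int (k $ i)\<bar>)"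
  let ?C = "(2 * pi) ^ CARD('n) * (1 + real CARD('n)) ^ N"
  have I: "\<bar>real_of_int (k $ i)\<bar> * ?I \<phi> = ?I (partial_deriv i \<phi>)" for i
    by (simp add: integral_character_partial_deriv[OF Suc.prems] norm_mult)
  have "?A ^ Suc N * ?I \<phi> = ?A ^ N * (?I \<phi> + (\<Sum>i\<in>UNIV. ?I (partial_deriv i \<phi>)))"
    by (simp add: I[symmetric] sum_distrib_right[symmetric] algebra_simps)
  also have "\<dots> = ?A ^ N * ?I \<phi> + (\<Sum>i\<in>UNIV. ?A ^ N * ?I (partial_deriv i \<phi>))"
    by (simp add: distrib_left sum_distrib_left)
  also have "\<dots> \<le> ?C * Ck_norm N \<phi> + (\<Sum>i\<in>(UNIV :: 'n set). ?C * Ck_norm N (partial_deriv i \<phi>))"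
    by (intro add_mono sum_mono Suc.IH Suc.prems test_function_partial)
  also have "\<dots> \<le> ?C * Ck_norm (Suc N) \<phi> + (\<Sum>i\<in>(UNIV :: 'n set). ?C * Ck_norm (Suc N) \<phi>)"
    by (intro add_mono sum_mono mult_left_mono Ck_norm_partial Ck_norm_mono Suc.prems) auto
  also have "\<dots> = (2 * pi) ^ CARD('n) * (1 + real CARD('n)) ^ Suc N * Ck_norm (Suc N) \<phi>"
    by (simp add: algebra_simps)
  finally show ?case .
qed

section \<open>Weights and lattice sums\<close>

definition weight :: "int^'n \<Rightarrow> real" where
  "weight k = 1 + (norm (lattice_vec k))\<^sup>2"

lemma weight_ge_1: "weight k \<ge> 1"
  by (simp add: weight_def)

lemma weight_pos: "weight k > 0"
  using weight_ge_1[of k] by linarith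

lemma weight_neq_0 [simp]: "weight k \<noteq> 0"
  using weight_pos[of k] by simp

lemma norm_lattice_vec: "(norm (lattice_vec k))\<^sup>2 = (\<Sum>i\<in>UNIV. (real_of_int (k $ i))\<^sup>2)"
  unfolding power2_norm_eq_inner inner_vec_def by (simp add: lattice_vec_def power2_eq_square)

text \<open>Translates decay in the l1-size of k, as in \<open>cmod_integral_character_le\<close>,
  into decay in the weight.\<close>

lemma weight_le: "weight k \<le> (1 + (\<Sum>i\<in>UNIV. \<bar>real_of_int (k $ i)\<bar>))\<^sup>2"
proof -
  have "norm (lattice_vec k) \<le> (\<Sum>i\<in>UNIV. \<bar>lattice_vec k $ i\<bar>)" by (rule norm_le_l1_cart)
  then have n: "norm (lattice_vec k) \<le> (\<Sum>i\<in>UNIV. \<bar>real_of_int (k $ i)\<bar>)" (is "_ \<le> ?S")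
    by (simp add: lattice_vec_def)
  then have "(norm (lattice_vec k))\<^sup>2 \<le> ?S\<^sup>2" by (intro power_mono) auto
  moreover have "?S \<ge> 0" by (intro sum_nonneg) auto
  ultimately show ?thesis unfolding weight_def power2_sum one_power2 mult_1_right by linarith
qed

lemma summable_on_int_inverse_square: "(\<lambda>j :: int. 1 / (1 + (real_of_int j)\<^sup>2)) summable_on UNIV"
proof -
  let ?g = "\<lambda>j :: int. 1 / (1 + (real_of_int j)\<^sup>2)"
  have "summable (\<lambda>n. 1 / (1 + (real n)\<^sup>2))"
  proof (rule summable_comparison_test')
    show "summable (\<lambda>n. inverse (real n ^ 2))" by (rule inverse_power_summable) simp
    show "norm (1 / (1 + (real n)\<^sup>2)) \<le> inverse (real n ^ 2)" if "n \<ge> 1" for n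
    proof -
      have "1 / (1 + (real n)\<^sup>2) \<le> 1 / (real n)\<^sup>2"
        using that by (intro divide_left_mono) (auto intro!: mult_pos_pos add_pos_nonneg)
      then show ?thesis by (simp add: power_inverse inverse_eq_divide)
    qed
  qed
  then have s: "(\<lambda>n. 1 / (1 + (real n)\<^sup>2)) summable_on UNIV"
    by (subst summable_on_UNIV_nonneg_real_iff) auto
  have 1: "?g summable_on range int"
    using s by (subst summable_on_reindex) (auto simp: o_def)
  have 2: "?g summable_on range (\<lambda>n. - int n)"
    using s by (subst summable_on_reindex) (auto simp: o_def inj_on_def)
  have "range int \<union> range (\<lambda>n. - int n) = UNIV"
  proof -
    have "j \<in> range int \<union> range (\<lambda>n. - int n)" for j
      by (cases j rule: int_cases2) auto
    then show ?thesis by blast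
  qed
  then show ?thesis using summable_on_union[OF 1 2] by simp
qed

text \<open>Each 1 + k_i^2 is at most the weight, so the n-th power of the weight dominates their
  product. Sums of the inverse products are bounded by a product of n convergent sums over the
  integers.\<close>

lemma summable_on_weight: "(\<lambda>k :: int^'n. 1 / weight k ^ CARD('n)) summable_on UNIV"
proof (rule summable_on_comparison_test)
  let ?g = "\<lambda>j :: int. 1 / (1 + (real_of_int j)\<^sup>2)"
  show "(\<lambda>k :: int^'n. \<Prod>i\<in>UNIV. ?g (k $ i)) summable_on UNIV"
  proof (rule nonneg_bdd_above_summable_on)
    show "bdd_above (sum (\<lambda>k :: int^'n. \<Prod>i\<in>UNIV. ?g (k $ i)) ` {F. F \<subseteq> UNIV \<and> finite F})"
    proof (rule bdd_aboveI2)
      fix F :: "(int^'n) set" assume "F \<in> {F. F \<subseteq> UNIV \<and> finite F}"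
      then have F: "finite F" by simp
      \<comment> \<open>All coordinates occurring in F, so that F embeds into a finite grid over
        which the sum factors.\<close>
      define J where "J = (\<Union>i. (\<lambda>k. k $ i) ` F)"
      have J: "finite J" unfolding J_def using F by auto
      have "(\<Sum>k\<in>F. \<Prod>i\<in>UNIV. ?g (k $ i)) = (\<Sum>g\<in>(\<lambda>k i. k $ i) ` F. \<Prod>i\<in>UNIV. ?g (g i))"
        by (subst sum.reindex) (auto simp: inj_on_def vec_eq_iff fun_eq_iff)
      also have "\<dots> \<le> (\<Sum>g\<in>PiE UNIV (\<lambda>i :: 'n. J). \<Prod>i\<in>UNIV. ?g (g i))"
        using J by (intro sum_mono2 finite_PiE prod_nonneg) (auto simp: J_def)
      also have "\<dots> = (\<Prod>i\<in>(UNIV :: 'n set). \<Sum>j\<in>J. ?g j)"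
        using J by (subst prod_sum_PiE) auto
      also have "\<dots> \<le> (\<Prod>i\<in>(UNIV :: 'n set). infsum ?g UNIV)"
        using J by (intro prod_mono conjI sum_nonneg finite_sum_le_infsum summable_on_int_inverse_square) auto
      finally show "(\<Sum>k\<in>F. \<Prod>i\<in>UNIV. ?g (k $ i)) \<le> (\<Prod>i\<in>(UNIV :: 'n set). infsum ?g UNIV)" .
    qed
  qed (auto intro!: prod_nonneg)
  fix k :: "int^'n"
  have "(\<Prod>i\<in>UNIV. 1 + (real_of_int (k $ i))\<^sup>2) \<le> (\<Prod>i\<in>(UNIV :: 'n set). weight k)"
  proof (intro prod_mono conjI)
    fix i
    have "(real_of_int (k $ i))\<^sup>2 \<le> (\<Sum>i\<in>UNIV. (real_of_int (k $ i))\<^sup>2)"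
      by (rule member_le_sum) auto
    then show "1 + (real_of_int (k $ i))\<^sup>2 \<le> weight k"
      by (simp add: weight_def norm_lattice_vec)
  qed auto
  then have p: "(\<Prod>i\<in>UNIV. 1 + (real_of_int (k $ i))\<^sup>2) \<le> weight k ^ CARD('n)" by simp
  have "(\<Prod>i\<in>UNIV. ?g (k $ i)) = 1 / (\<Prod>i\<in>UNIV. 1 + (real_of_int (k $ i))\<^sup>2)"
    by (simp add: prod_dividef)
  moreover have "(\<Prod>i\<in>UNIV. 1 + (real_of_int (k $ i))\<^sup>2) > 0"
    by (intro prod_pos) (auto intro: add_pos_nonneg)
  ultimately show "1 / weight k ^ CARD('n) \<le> (\<Prod>i\<in>UNIV. ?g (k $ i))"
    using p weight_pos[of k] by (auto intro!: divide_left_mono mult_pos_pos)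
  show "0 \<le> 1 / weight k ^ CARD('n)" using weight_pos[of k] by simp
qed

section \<open>Trigonometric series as distributions\<close>

text \<open>Tested against a character, the series has at most one nonzero summand by orthogonality,
  so the identity holds whatever the growth of c.\<close>

lemma fourier_coeff_fourier_series [simp]: "fourier_coeff (fourier_series c) k = c k"
  for c :: "int^'n \<Rightarrow> complex"
proof -
  have I: "integral torus (\<lambda>x. character l x * character (- k) x) =
      (if l = k then complex_of_real ((2 * pi) ^ CARD('n)) else 0)" for l
    using integral_character[of "l + - k"] by (simp add: character_mult)
  have "(\<Sum>\<^sub>\<infinity>l\<in>UNIV. c l * integral torus (\<lambda>x. character l x * character (- k) x)) =
      (\<Sum>\<^sub>\<infinity>l\<in>{k}. c l * integral torus (\<lambda>x. character l x * character (- k) x))"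
    by (rule infsum_cong_neutral) (auto simp: I)
  then show ?thesis
    by (simp add: fourier_coeff_def fourier_series_def character_test_function I)
qed

text \<open>The integrals of characters against a test function decay faster than any power of the
  weight, with constants given by a norm of finite order. Polynomial growth of c therefore leaves an
  absolutely convergent series.\<close>

lemma fourier_series_distribution:
  fixes c :: "int^'n \<Rightarrow> complex"
  assumes c: "\<And>k. cmod (c k) \<le> C * weight k powr p"
  shows "fourier_series c \<in> periodic_distributions"
proof -
  \<comment> \<open>Then p - M \<le> - n, which leaves the summable inverse n-th power of the
    weight. As the weight is quadratic in k, this takes \<open>2 * M\<close> derivatives.\<close>
  define M where "M = nat \<lceil>p + real CARD('n)\<rceil>"
  have M: "real M \<ge> p + real CARD('n)" unfolding M_def by linarith
  define K where "K = \<bar>C\<bar> * ((2 * pi) ^ CARD('n) * (1 + real CARD('n)) ^ (2 * M))"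
  have K: "K \<ge> 0" unfolding K_def by simp
  let ?I = "\<lambda>\<phi> k. integral torus (\<lambda>x. character k x * \<phi> x)"
  have summand: "norm (c k * ?I \<phi> k) \<le> K * Ck_norm (2 * M) \<phi> * (1 / weight k ^ CARD('n))"
    if \<phi>: "\<phi> \<in> test_functions" for \<phi> :: "real^'n \<Rightarrow> complex" and k
  proof -
    have "weight k ^ M * cmod (?I \<phi> k) \<le> ((1 + (\<Sum>i\<in>UNIV. \<bar>real_of_int (k $ i)\<bar>))\<^sup>2) ^ M * cmod (?I \<phi> k)"
      using weight_pos[of k] by (intro mult_right_mono power_mono weight_le) auto
    also have "\<dots> \<le> (2 * pi) ^ CARD('n) * (1 + real CARD('n)) ^ (2 * M) * Ck_norm (2 * M) \<phi>"
      using cmod_integral_character_le[OF \<phi>, of k "2 * M"] by (simp add: power_mult)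
    finally have 1: "weight k ^ M * cmod (?I \<phi> k) \<le> \<dots>" .
    have "cmod (c k) \<le> \<bar>C\<bar> * weight k powr p"
      by (rule order_trans[OF c]) (intro mult_right_mono; simp)
    also have "weight k powr p \<le> weight k powr (real M - real CARD('n))"
      using M weight_ge_1 by (intro powr_mono) auto
    also have "\<dots> = weight k ^ M / weight k ^ CARD('n)"
      using weight_pos[of k] by (simp add: powr_diff powr_realpow)
    finally have 2: "cmod (c k) \<le> \<bar>C\<bar> * (weight k ^ M / weight k ^ CARD('n))"
      by (simp add: mult_left_mono)
    have "norm (c k * ?I \<phi> k) \<le> \<bar>C\<bar> * (weight k ^ M / weight k ^ CARD('n)) * cmod (?I \<phi> k)"
      unfolding norm_mult by (rule mult_right_mono[OF 2]) simp
    also have "\<dots> = \<bar>C\<bar> * (1 / weight k ^ CARD('n)) * (weight k ^ M * cmod (?I \<phi> k))"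
      by simp
    also have "\<dots> \<le> \<bar>C\<bar> * (1 / weight k ^ CARD('n)) *
        ((2 * pi) ^ CARD('n) * (1 + real CARD('n)) ^ (2 * M) * Ck_norm (2 * M) \<phi>)"
      using weight_pos[of k] by (intro mult_left_mono[OF 1]) auto
    also have "\<dots> = K * Ck_norm (2 * M) \<phi> * (1 / weight k ^ CARD('n))"
      by (simp add: K_def)
    finally show ?thesis .
  qed
  have sw: "(\<lambda>k :: int^'n. K * Ck_norm (2 * M) \<phi> * (1 / weight k ^ CARD('n))) summable_on UNIV" for \<phi> :: "real^'n \<Rightarrow> complex"
    by (intro summable_on_cmult_right summable_on_weight)
  have summable: "(\<lambda>k. c k * ?I \<phi> k) summable_on UNIV" if "\<phi> \<in> test_functions" for \<phi>
    by (rule abs_summable_summable, rule summable_on_comparison_test[OF sw])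
      (rule summand[OF that], rule norm_ge_zero)
  have bound: "cmod (fourier_series c \<phi>) \<le> (K * (\<Sum>\<^sub>\<infinity>k\<in>UNIV. 1 / weight (k :: int^'n) ^ CARD('n))) * Ck_norm (2 * M) \<phi>"
    if \<phi>: "\<phi> \<in> test_functions" for \<phi>
  proof -
    have "norm (infsum (\<lambda>k. c k * ?I \<phi> k) UNIV) \<le>
        infsum (\<lambda>k :: int^'n. K * Ck_norm (2 * M) \<phi> * (1 / weight k ^ CARD('n))) UNIV"
      by (rule norm_infsum_le[OF has_sum_infsum[OF summable[OF \<phi>]] has_sum_infsum[OF sw]])
        (rule summand[OF \<phi>])
    also have "\<dots> = K * Ck_norm (2 * M) \<phi> * infsum (\<lambda>k :: int^'n. 1 / weight k ^ CARD('n)) UNIV"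
      by (rule infsum_cmult_right) (rule summable_on_weight)
    finally show ?thesis using \<phi> by (simp add: fourier_series_def mult_ac)
  qed
  have add: "fourier_series c (\<lambda>x. \<phi> x + \<psi> x) = fourier_series c \<phi> + fourier_series c \<psi>"
    if "\<phi> \<in> test_functions" "\<psi> \<in> test_functions" for \<phi> \<psi>
  proof -
    have "c k * ?I (\<lambda>x. \<phi> x + \<psi> x) k = c k * ?I \<phi> k + c k * ?I \<psi> k" for k
      using that
      by (simp add: distrib_left Henstock_Kurzweil_Integration.integral_add character_times_integrable)
    then show ?thesis
      using that by (simp add: fourier_series_def test_function_add infsum_add summable)
  qed
  have cmult: "fourier_series c (\<lambda>x. a * \<phi> x) = a * fourier_series c \<phi>"
    if "\<phi> \<in> test_functions" for \<phi> a
  proof -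
    have "c k * ?I (\<lambda>x. a * \<phi> x) k = a * (c k * ?I \<phi> k)" for k
      by (simp add: mult.left_commute[of _ a])
    then have "(\<lambda>k. c k * ?I (\<lambda>x. a * \<phi> x) k) = (\<lambda>k. a * (c k * ?I \<phi> k))" by blast
    then show ?thesis
      using that test_function_cmult[OF that]
      by (simp only: fourier_series_def if_True infsum_cmult_right')
  qed
  have "\<exists>C N. \<forall>\<phi>\<in>test_functions. cmod (fourier_series c \<phi>) \<le> C * Ck_norm N \<phi>"
    using bound by blast
  moreover have "fourier_series c \<phi> = 0" if "\<phi> \<notin> test_functions" for \<phi>
    using that by (simp add: fourier_series_def)
  ultimately show ?thesis
    unfolding periodic_distributions_def using add cmult by blast
qed

lemma sobolev_term_eq: "sobolev_term q T k = weight k powr q * (cmod (fourier_coeff T k))\<^sup>2"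
  by (simp add: sobolev_term_def weight_def)

text \<open>A single term is at most the whole sum. This supplies the polynomial growth bound
  assumed in \<open>fourier_series_distribution\<close>.\<close>

lemma weighted_square_summable_bound:
  fixes c :: "int^'n \<Rightarrow> complex"
  assumes "(\<lambda>k. weight k powr q * (cmod (c k))\<^sup>2) summable_on UNIV"
  shows "\<exists>C\<ge>0. \<forall>k. cmod (c k) \<le> C * weight k powr (- q / 2)"
proof -
  let ?S = "\<Sum>\<^sub>\<infinity>k\<in>UNIV. weight k powr q * (cmod (c k))\<^sup>2"
  have S: "?S \<ge> 0" by (intro infsum_nonneg) auto
  have "cmod (c k) \<le> sqrt ?S * weight k powr (- q / 2)" for k
  proof -
    have "weight k powr q * (cmod (c k))\<^sup>2 \<le> ?S"
      using finite_sum_le_infsum[OF assms, of "{k}"] by simp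
    then have "(cmod (c k))\<^sup>2 \<le> ?S * weight k powr (- q)"
      using weight_pos[of k] by (simp add: powr_minus field_simps)
    also have "\<dots> = (sqrt ?S * weight k powr (- q / 2))\<^sup>2"
      using S by (simp add: power_mult_distrib) (simp add: power2_eq_square powr_add[symmetric])
    finally show ?thesis using S by (simp add: power2_le_iff_abs_le)
  qed
  then show ?thesis using S by (intro exI[of _ "sqrt ?S"]) auto
qed

lemma fourier_series_sobolev:
  assumes "(\<lambda>k. weight k powr q * (cmod (c k))\<^sup>2) summable_on UNIV"
  shows "fourier_series c \<in> sobolev q"
  using weighted_square_summable_bound[OF assms] fourier_series_distribution assms
  by (auto simp: sobolev_def sobolev_term_eq[abs_def])

section \<open>Operations on distributions\<close>

lemma periodic_distributionsD:
  assumes "T \<in> periodic_distributions"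
  shows "\<phi> \<notin> test_functions \<Longrightarrow> T \<phi> = 0"
    and "\<phi> \<in> test_functions \<Longrightarrow> \<psi> \<in> test_functions \<Longrightarrow> T (\<lambda>x. \<phi> x + \<psi> x) = T \<phi> + T \<psi>"
    and "\<phi> \<in> test_functions \<Longrightarrow> T (\<lambda>x. c * \<phi> x) = c * T \<phi>"
    and "\<exists>C\<ge>0. \<exists>N. \<forall>\<phi>\<in>test_functions. cmod (T \<phi>) \<le> C * Ck_norm N \<phi>"
proof -
  obtain C N where CN: "\<forall>\<phi>\<in>test_functions. cmod (T \<phi>) \<le> C * Ck_norm N \<phi>"
    using assms unfolding periodic_distributions_def by blast
  have "cmod (T \<phi>) \<le> \<bar>C\<bar> * Ck_norm N \<phi>" if "\<phi> \<in> test_functions" for \<phi>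
    using CN that mult_right_mono[OF abs_ge_self[of C] Ck_norm_nonneg[OF that, of N]] by fastforce
  then show "\<exists>C\<ge>0. \<exists>N. \<forall>\<phi>\<in>test_functions. cmod (T \<phi>) \<le> C * Ck_norm N \<phi>"
    by (intro exI[of _ "\<bar>C\<bar>"]) auto
qed (use assms in \<open>auto simp: periodic_distributions_def\<close>)

lemma periodic_distributions_add:
  assumes S: "S \<in> periodic_distributions" and T: "T \<in> periodic_distributions"
  shows "(\<lambda>\<phi>. S \<phi> + T \<phi>) \<in> periodic_distributions"
proof -
  obtain C M where C: "C \<ge> 0" "\<forall>\<phi>\<in>test_functions. cmod (S \<phi>) \<le> C * Ck_norm M \<phi>"
    using periodic_distributionsD(4)[OF S] by blast
  obtain D N where D: "D \<ge> 0" "\<forall>\<phi>\<in>test_functions. cmod (T \<phi>) \<le> D * Ck_norm N \<phi>"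
    using periodic_distributionsD(4)[OF T] by blast
  have "cmod (S \<phi> + T \<phi>) \<le> (C + D) * Ck_norm (M + N) \<phi>" if \<phi>: "\<phi> \<in> test_functions" for \<phi>
  proof -
    have "cmod (S \<phi> + T \<phi>) \<le> C * Ck_norm M \<phi> + D * Ck_norm N \<phi>"
      using C(2) D(2) \<phi> by (intro norm_triangle_le add_mono) auto
    also have "\<dots> \<le> C * Ck_norm (M + N) \<phi> + D * Ck_norm (M + N) \<phi>"
      using C(1) D(1) \<phi> by (intro add_mono mult_left_mono Ck_norm_mono) auto
    finally show ?thesis by (simp add: distrib_right)
  qed
  then have "\<exists>C N. \<forall>\<phi>\<in>test_functions. cmod (S \<phi> + T \<phi>) \<le> C * Ck_norm N \<phi>" by blast
  then show ?thesis
    using periodic_distributionsD(1-3)[OF S] periodic_distributionsD(1-3)[OF T]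
    unfolding periodic_distributions_def by (auto simp: algebra_simps)
qed

lemma periodic_distributions_cmult:
  assumes T: "T \<in> periodic_distributions"
  shows "(\<lambda>\<phi>. a * T \<phi>) \<in> periodic_distributions"
proof -
  obtain D N where D: "D \<ge> 0" "\<forall>\<phi>\<in>test_functions. cmod (T \<phi>) \<le> D * Ck_norm N \<phi>"
    using periodic_distributionsD(4)[OF T] by blast
  have "cmod (a * T \<phi>) \<le> (cmod a * D) * Ck_norm N \<phi>" if \<phi>: "\<phi> \<in> test_functions" for \<phi>
    using D(2) \<phi> by (auto simp: norm_mult mult.assoc intro!: mult_left_mono)
  then have "\<exists>C N. \<forall>\<phi>\<in>test_functions. cmod (a * T \<phi>) \<le> C * Ck_norm N \<phi>" by blast
  then show ?thesis
    using periodic_distributionsD(1-3)[OF T]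
    unfolding periodic_distributions_def by (auto simp: algebra_simps)
qed

lemma periodic_distributions_difference_quotient:
  assumes "S \<in> periodic_distributions" "T \<in> periodic_distributions"
  shows "(\<lambda>\<phi>. (S \<phi> - T \<phi>) / a) \<in> periodic_distributions"
  using periodic_distributions_cmult[OF periodic_distributions_add[OF assms(1)
      periodic_distributions_cmult[OF assms(2), of "-1"]], of "1 / a"]
  by (simp add: field_simps)

lemma fourier_coeff_add: "fourier_coeff (\<lambda>\<phi>. S \<phi> + T \<phi>) k = fourier_coeff S k + fourier_coeff T k"
  by (simp add: fourier_coeff_def add_divide_distrib)

lemma fourier_coeff_diff: "fourier_coeff (\<lambda>\<phi>. S \<phi> - T \<phi>) k = fourier_coeff S k - fourier_coeff T k"
  by (simp add: fourier_coeff_def diff_divide_distrib)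

lemma fourier_coeff_divide: "fourier_coeff (\<lambda>\<phi>. T \<phi> / a) k = fourier_coeff T k / a"
  by (simp add: fourier_coeff_def)

lemma laplacian_test_function:
  assumes "\<phi> \<in> test_functions"
  shows "(\<lambda>x. \<Sum>i\<in>UNIV. partial_deriv i (partial_deriv i \<phi>) x) \<in> test_functions"
  using test_function_sum[of UNIV "\<lambda>i. partial_deriv i (partial_deriv i \<phi>)"]
  by (simp add: test_function_partial assms)

text \<open>The Laplacian acts on the test function, so continuity costs two more derivatives and a
  factor n.\<close>

lemma laplacian_distribution:
  fixes T :: "(real^'n \<Rightarrow> complex) \<Rightarrow> complex"
  assumes T: "T \<in> periodic_distributions"
  shows "laplacian T \<in> periodic_distributions"
proof -
  define L :: "(real^'n \<Rightarrow> complex) \<Rightarrow> real^'n \<Rightarrow> complex"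
    where "L = (\<lambda>\<phi> x. \<Sum>i\<in>UNIV. partial_deriv i (partial_deriv i \<phi>) x)"
  have L: "L \<phi> \<in> test_functions" if "\<phi> \<in> test_functions" for \<phi>
    using laplacian_test_function[OF that] by (simp add: L_def)
  have lap: "laplacian T \<phi> = (if \<phi> \<in> test_functions then T (L \<phi>) else 0)" for \<phi>
    by (simp add: laplacian_def L_def)
  have add: "L (\<lambda>x. \<phi> x + \<psi> x) = (\<lambda>x. L \<phi> x + L \<psi> x)"
    if "\<phi> \<in> test_functions" "\<psi> \<in> test_functions" for \<phi> \<psi>
    using that unfolding L_def
    by (simp add: partial_deriv_add test_function_partial test_function_differentiable' sum.distrib)
  have cmult: "L (\<lambda>x. c * \<phi> x) = (\<lambda>x. c * L \<phi> x)" if "\<phi> \<in> test_functions" for c \<phi>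
    using that unfolding L_def
    by (simp add: partial_deriv_cmult test_function_partial test_function_differentiable' sum_distrib_left)
  obtain D N where D: "D \<ge> 0" "\<forall>\<phi>\<in>test_functions. cmod (T \<phi>) \<le> D * Ck_norm N \<phi>"
    using periodic_distributionsD(4)[OF T] by blast
  have "cmod (laplacian T \<phi>) \<le> (D * real CARD('n)) * Ck_norm (Suc (Suc N)) \<phi>"
    if \<phi>: "\<phi> \<in> test_functions" for \<phi>
  proof -
    have "Ck_norm N (L \<phi>) \<le> (\<Sum>i\<in>(UNIV :: 'n set). Ck_norm N (partial_deriv i (partial_deriv i \<phi>)))"
      unfolding L_def by (rule Ck_norm_sum) (auto intro: test_function_partial \<phi>)
    also have "\<dots> \<le> (\<Sum>i\<in>(UNIV :: 'n set). Ck_norm (Suc (Suc N)) \<phi>)"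
      by (intro sum_mono order_trans[OF Ck_norm_partial Ck_norm_partial] test_function_partial \<phi>)
    finally have "Ck_norm N (L \<phi>) \<le> real CARD('n) * Ck_norm (Suc (Suc N)) \<phi>" by simp
    then have "D * Ck_norm N (L \<phi>) \<le> D * (real CARD('n) * Ck_norm (Suc (Suc N)) \<phi>)"
      using D(1) by (rule mult_left_mono)
    moreover have "cmod (laplacian T \<phi>) \<le> D * Ck_norm N (L \<phi>)"
      using D(2) L[OF \<phi>] \<phi> by (simp add: lap)
    ultimately show ?thesis by (simp add: mult.assoc)
  qed
  then have "\<exists>C N. \<forall>\<phi>\<in>test_functions. cmod (laplacian T \<phi>) \<le> C * Ck_norm N \<phi>" by blast
  moreover have "laplacian T (\<lambda>x. \<phi> x + \<psi> x) = laplacian T \<phi> + laplacian T \<psi>"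
    if "\<phi> \<in> test_functions" "\<psi> \<in> test_functions" for \<phi> \<psi>
    using that by (simp add: lap test_function_add add L periodic_distributionsD(2)[OF T])
  moreover have "laplacian T (\<lambda>x. c * \<phi> x) = c * laplacian T \<phi>"
    if "\<phi> \<in> test_functions" for c \<phi>
    using that by (simp add: lap test_function_cmult cmult L periodic_distributionsD(3)[OF T])
  ultimately show ?thesis
    unfolding periodic_distributions_def by (auto simp: lap)
qed

text \<open>The character of - k is an eigenfunction of the Laplacian with eigenvalue minus the
  squared norm of k.\<close>

lemma fourier_coeff_laplacian:
  assumes T: "T \<in> periodic_distributions"
  shows "fourier_coeff (laplacian T) k = - complex_of_real ((norm (lattice_vec k))\<^sup>2) * fourier_coeff T k"
proof -
  have i: "\<i> * c * (\<i> * c * d) = - (c * c * d)" for c d :: complex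
  proof -
    have "\<i> * c * (\<i> * c * d) = (\<i> * \<i>) * (c * c * d)" by (simp only: mult_ac)
    then show ?thesis by simp
  qed
  have "partial_deriv i (partial_deriv i (character (- k))) =
      (\<lambda>x. - of_int ((k $ i)\<^sup>2) * character (- k) x)" for i
    unfolding partial_deriv_character partial_deriv_cmult[OF character_differentiable]
    by (simp add: fun_eq_iff power2_eq_square i)
  then have "(\<lambda>x. \<Sum>i\<in>UNIV. partial_deriv i (partial_deriv i (character (- k))) x) =
      (\<lambda>x. - complex_of_real ((norm (lattice_vec k))\<^sup>2) * character (- k) x)"
    by (simp add: norm_lattice_vec sum_distrib_right[symmetric] sum_negf)
  then show ?thesis
    by (simp only: fourier_coeff_def laplacian_def character_test_function if_True
        periodic_distributionsD(3)[OF T character_test_function] times_divide_eq_right)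
qed

section \<open>Dominated convergence in Sobolev spaces\<close>

text \<open>Dominated convergence along an arbitrary filter: off a finite set the tail of g bounds
  the tail of \<open>f a\<close> by e/2, and on the finite set finitely many limits give the other
  e/2.\<close>

lemma infsum_dominated_tendsto_0:
  fixes f :: "'a \<Rightarrow> 'k \<Rightarrow> real"
  assumes g: "g summable_on UNIV"
    and dom: "\<forall>\<^sub>F a in F. \<forall>k. 0 \<le> f a k \<and> f a k \<le> g k"
    and lim: "\<And>k. ((\<lambda>a. f a k) \<longlongrightarrow> 0) F"
  shows "((\<lambda>a. infsum (f a) UNIV) \<longlongrightarrow> 0) F"
proof (rule tendstoI)
  fix e :: real assume e: "e > 0"
  obtain A where A: "finite A" "dist (sum g A) (infsum g UNIV) \<le> e / 2"
    using infsum_finite_approximation[OF g, of "e / 2"] e by auto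
  have "((\<lambda>a. \<Sum>k\<in>A. f a k) \<longlongrightarrow> (\<Sum>k\<in>A. 0)) F" by (intro tendsto_sum lim)
  then have "\<forall>\<^sub>F a in F. (\<Sum>k\<in>A. f a k) < e / 2"
    using e by (intro order_tendstoD(2)) auto
  with dom show "\<forall>\<^sub>F a in F. dist (infsum (f a) UNIV) 0 < e"
  proof eventually_elim
    fix a
    assume f: "\<forall>k. 0 \<le> f a k \<and> f a k \<le> g k" and sA: "(\<Sum>k\<in>A. f a k) < e / 2"
    have fs: "f a summable_on UNIV"
      by (rule summable_on_comparison_test[OF g]) (use f in auto)
    have split: "infsum h UNIV = sum h A + infsum h (- A)" if "h summable_on UNIV" for h :: "'k \<Rightarrow> real"
    proof -
      have "infsum h (A \<union> - A) = infsum h A + infsum h (- A)"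
        using A(1) summable_on_subset_banach[OF that] by (intro infsum_Un_disjoint) auto
      then show ?thesis using A(1) by simp
    qed
    have "infsum (f a) (- A) \<le> infsum g (- A)"
      by (rule infsum_mono[OF summable_on_subset_banach[OF fs] summable_on_subset_banach[OF g]])
        (use f in auto)
    also have "\<dots> = infsum g UNIV - sum g A" using split[OF g] by simp
    also have "\<dots> \<le> e / 2" using A(2) unfolding dist_real_def by linarith
    finally have "infsum (f a) UNIV < e" using split[OF fs] sA by linarith
    moreover have "infsum (f a) UNIV \<ge> 0" by (rule infsum_nonneg) (use f in auto)
    ultimately show "dist (infsum (f a) UNIV) 0 < e" by simp
  qed
qed

text \<open>Reduces convergence in norm to convergence of each Fourier coefficient and one summable
  majorant. It serves both the time derivatives and the limit in \<beta>.\<close>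

lemma tendsto_sobolev_dominated:
  assumes T: "T \<in> sobolev q" and S: "\<forall>\<^sub>F a in F. S a \<in> sobolev q"
    and g: "g summable_on UNIV"
    and dom: "\<forall>\<^sub>F a in F. \<forall>k. weight k powr q * (cmod (fourier_coeff (S a) k - fourier_coeff T k))\<^sup>2 \<le> g k"
    and lim: "\<And>k. ((\<lambda>a. fourier_coeff (S a) k) \<longlongrightarrow> fourier_coeff T k) F"
  shows "tendsto_sobolev q S T F"
proof -
  have "((\<lambda>a. infsum (sobolev_term q (\<lambda>\<phi>. S a \<phi> - T \<phi>)) UNIV) \<longlongrightarrow> 0) F"
  proof (rule infsum_dominated_tendsto_0[OF g])
    show "\<forall>\<^sub>F a in F. \<forall>k. 0 \<le> sobolev_term q (\<lambda>\<phi>. S a \<phi> - T \<phi>) k \<and> sobolev_term q (\<lambda>\<phi>. S a \<phi> - T \<phi>) k \<le> g k"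
      using dom by eventually_elim (simp add: sobolev_term_eq fourier_coeff_diff)
    fix k
    have "((\<lambda>a. weight k powr q * (cmod (fourier_coeff (S a) k - fourier_coeff T k))\<^sup>2) \<longlongrightarrow>
        weight k powr q * (cmod (fourier_coeff T k - fourier_coeff T k))\<^sup>2) F"
      by (intro tendsto_intros lim)
    then show "((\<lambda>a. sobolev_term q (\<lambda>\<phi>. S a \<phi> - T \<phi>) k) \<longlongrightarrow> 0) F"
      by (simp add: sobolev_term_eq fourier_coeff_diff)
  qed
  then have "((\<lambda>a. sobolev_norm q (\<lambda>\<phi>. S a \<phi> - T \<phi>)) \<longlongrightarrow> sqrt 0) F"
    unfolding sobolev_norm_def by (rule tendsto_real_sqrt)
  then show ?thesis using T S by (simp add: tendsto_sobolev_def)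
qed

text \<open>Squaring doubles the exponent: r powers of the weight gained by a coefficient raise the
  Sobolev order by 2 r.\<close>

lemma weighted_square_le:
  assumes "weight k powr r * cmod d \<le> B * cmod c"
  shows "weight k powr (q + 2 * r) * (cmod d)\<^sup>2 \<le> B\<^sup>2 * (weight k powr q * (cmod c)\<^sup>2)"
proof -
  have "weight k powr (q + 2 * r) = weight k powr q * (weight k powr r)\<^sup>2"
  proof -
    have "q + 2 * r = q + (r + r)" by simp
    then show ?thesis by (simp only: powr_add power2_eq_square)
  qed
  then have "weight k powr (q + 2 * r) * (cmod d)\<^sup>2 = weight k powr q * (weight k powr r * cmod d)\<^sup>2"
    by (simp add: power_mult_distrib)
  also have "\<dots> \<le> weight k powr q * (B * cmod c)\<^sup>2"
    using assms by (intro mult_left_mono power_mono) auto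
  finally show ?thesis by (simp add: power_mult_distrib mult_ac)
qed

lemma sobolev_summable: "b \<in> sobolev q \<Longrightarrow> (\<lambda>k. weight k powr q * (cmod (fourier_coeff b k))\<^sup>2) summable_on UNIV"
  by (simp add: sobolev_def sobolev_term_eq[abs_def])

lemma weighted_summable_gain:
  assumes b: "b \<in> sobolev q"
    and c: "\<And>k. weight k powr r * cmod (c k) \<le> B * cmod (fourier_coeff b k)"
  shows "(\<lambda>k. weight k powr (q + 2 * r) * (cmod (c k))\<^sup>2) summable_on UNIV"
  by (rule summable_on_comparison_test[OF summable_on_cmult_right[OF sobolev_summable[OF b], of "B\<^sup>2"]])
    (use weighted_square_le[OF c] in auto)

lemma fourier_series_sobolev_gain:
  assumes "b \<in> sobolev q"
    and "\<And>k. weight k powr r * cmod (c k) \<le> B * cmod (fourier_coeff b k)"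
  shows "fourier_series c \<in> sobolev (q + 2 * r)"
  by (rule fourier_series_sobolev[OF weighted_summable_gain[OF assms]])

lemma fourier_series_sobolev_dominated:
  assumes "b \<in> sobolev q" and "\<And>k. cmod (c k) \<le> B * cmod (fourier_coeff b k)"
  shows "fourier_series c \<in> sobolev q"
  using fourier_series_sobolev_gain[of b q 0 c B] assms by simp

lemma sobolev_dominated:
  assumes "T \<in> periodic_distributions" and "b \<in> sobolev q"
    and "\<And>k. cmod (fourier_coeff T k) \<le> B * cmod (fourier_coeff b k)"
  shows "T \<in> sobolev q"
  using weighted_summable_gain[of b q 0 "fourier_coeff T" B] assms
  by (simp add: sobolev_def sobolev_term_eq[abs_def])

section \<open>The wave equation mode by mode\<close>

text \<open>The solution of y'' + \<omega>^2 y = 1 with zero initial data. The value at \<omega> = 0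
  is the limit, so the zero mode fits the same formula.\<close>

definition wave_mode :: "real \<Rightarrow> real \<Rightarrow> real" where
  "wave_mode \<omega> t = (if \<omega> = 0 then t\<^sup>2 / 2 else (1 - cos (\<omega> * t)) / \<omega>\<^sup>2)"

definition wave_velocity :: "real \<Rightarrow> real \<Rightarrow> real" where
  "wave_velocity \<omega> t = (if \<omega> = 0 then t else sin (\<omega> * t) / \<omega>)"

lemma wave_mode_0 [simp]: "wave_mode \<omega> 0 = 0"
  by (simp add: wave_mode_def)

lemma wave_velocity_0 [simp]: "wave_velocity \<omega> 0 = 0"
  by (simp add: wave_velocity_def)

lemma DERIV_wave_mode: "(wave_mode \<omega> has_real_derivative wave_velocity \<omega> t) (at t)"
  by (cases "\<omega> = 0")
    (auto simp: wave_mode_def[abs_def] wave_velocity_def power2_eq_square intro!: derivative_eq_intros)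

lemma DERIV_wave_velocity: "(wave_velocity \<omega> has_real_derivative cos (\<omega> * t)) (at t)"
  by (cases "\<omega> = 0") (auto simp: wave_velocity_def[abs_def] intro!: derivative_eq_intros)

lemma abs_wave_velocity_le: "\<bar>wave_velocity \<omega> t\<bar> \<le> \<bar>t\<bar>"
  using abs_sin_x_le_abs_x[of "\<omega> * t"] by (simp add: wave_velocity_def abs_mult divide_le_eq mult.commute)

lemma abs_wave_mode_le: "\<bar>wave_mode \<omega> t\<bar> \<le> t\<^sup>2 / 2"
proof -
  have "1 - cos x \<le> x\<^sup>2 / 2" for x :: real
  proof -
    have "1 - cos x = 2 * (sin (x / 2))\<^sup>2" using cos_double_sin[of "x / 2"] by simp
    moreover have "(sin (x / 2))\<^sup>2 \<le> (x / 2)\<^sup>2"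
      using abs_sin_x_le_abs_x[of "x / 2"] abs_le_square_iff by blast
    ultimately show ?thesis by (simp add: power_divide)
  qed
  from this[of "\<omega> * t"] show ?thesis
    by (simp add: wave_mode_def divide_simps power_mult_distrib mult_ac)
qed

text \<open>Complements \<open>abs_wave_mode_le\<close>: that bound is uniform in \<omega>, this one
  is uniform in t and yields the gain of regularity.\<close>

lemma abs_wave_mode_le': "\<omega> \<noteq> 0 \<Longrightarrow> \<bar>wave_mode \<omega> t\<bar> \<le> 2 / \<omega>\<^sup>2"
  using cos_ge_minus_one[of "\<omega> * t"] by (simp add: wave_mode_def divide_right_mono)

lemma abs_difference_quotient_le:
  fixes f :: "real \<Rightarrow> real"
  assumes "\<And>x. (f has_real_derivative f' x) (at x)" "\<And>x. \<bar>x\<bar> \<le> \<bar>t\<bar> + \<bar>h\<bar> \<Longrightarrow> \<bar>f' x\<bar> \<le> B"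
  shows "\<bar>f (t + h) - f t\<bar> \<le> B * \<bar>h\<bar>"
  using field_differentiable_bound[of "cball 0 (\<bar>t\<bar> + \<bar>h\<bar>)" f f' B "t + h" t] assms
  by (auto intro: has_field_derivative_at_within simp: convex_cball abs_triangle_ineq)

text \<open>Both wave equations are instances, as A enters through its action on Fourier
  coefficients. For fixed t the modes of U and of its first two derivatives are bounded uniformly in
  k, so all three stay in the space of b.\<close>

lemma solves_wave_series:
  fixes b :: "(real^'n \<Rightarrow> complex) \<Rightarrow> complex" and \<omega> :: "int^'n \<Rightarrow> real"
  defines "U \<equiv> \<lambda>t. fourier_series (\<lambda>k. fourier_coeff b k * complex_of_real (wave_mode (\<omega> k) t))"
  assumes b: "b \<in> sobolev q"
    and A: "\<And>t. A (U t) \<in> periodic_distributions"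
    and A_coeff: "\<And>t k. fourier_coeff (A (U t)) k = - complex_of_real ((\<omega> k)\<^sup>2) * fourier_coeff (U t) k"
  shows "solves_wave q A b U"
proof -
  define V where "V = (\<lambda>t. fourier_series (\<lambda>k. fourier_coeff b k * complex_of_real (wave_velocity (\<omega> k) t)))"
  \<comment> \<open>The second derivative; its modes turn out to be cos(\<omega> t), the derivative
    of the velocity modes.\<close>
  define W where "W = (\<lambda>t \<phi>. A (U t) \<phi> + b \<phi>)"
  have Uc: "fourier_coeff (U t) k = fourier_coeff b k * complex_of_real (wave_mode (\<omega> k) t)" for t k
    by (simp add: U_def)
  have Vc: "fourier_coeff (V t) k = fourier_coeff b k * complex_of_real (wave_velocity (\<omega> k) t)" for t k
    by (simp add: V_def)
  have Wc: "fourier_coeff (W t) k = fourier_coeff b k * complex_of_real (cos (\<omega> k * t))" for t k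
  proof -
    have "1 - (\<omega> k)\<^sup>2 * wave_mode (\<omega> k) t = cos (\<omega> k * t)" by (simp add: wave_mode_def)
    then have cos: "complex_of_real (cos (\<omega> k * t)) = 1 - complex_of_real ((\<omega> k)\<^sup>2) * complex_of_real (wave_mode (\<omega> k) t)"
      by (metis of_real_1 of_real_diff of_real_mult)
    show ?thesis
      unfolding cos by (simp add: W_def fourier_coeff_add A_coeff Uc algebra_simps)
  qed
  have b_dist: "b \<in> periodic_distributions" using b by (simp add: sobolev_def)
  have U: "U t \<in> sobolev q" for t
    unfolding U_def
  proof (rule fourier_series_sobolev_dominated[OF b, where B = "t\<^sup>2 / 2"])
    show "cmod (fourier_coeff b k * complex_of_real (wave_mode (\<omega> k) t)) \<le> t\<^sup>2 / 2 * cmod (fourier_coeff b k)" for k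
      using mult_left_mono[OF abs_wave_mode_le[of "\<omega> k" t], of "cmod (fourier_coeff b k)"]
      by (simp add: norm_mult mult.commute)
  qed
  have V: "V t \<in> sobolev q" for t
    unfolding V_def
  proof (rule fourier_series_sobolev_dominated[OF b, where B = "\<bar>t\<bar>"])
    show "cmod (fourier_coeff b k * complex_of_real (wave_velocity (\<omega> k) t)) \<le> \<bar>t\<bar> * cmod (fourier_coeff b k)" for k
      using mult_left_mono[OF abs_wave_velocity_le[of "\<omega> k" t], of "cmod (fourier_coeff b k)"]
      by (simp add: norm_mult mult.commute)
  qed
  have W: "W t \<in> sobolev q" for t
  proof (rule sobolev_dominated[OF _ b, where B = 1])
    show "W t \<in> periodic_distributions"
      unfolding W_def by (rule periodic_distributions_add[OF A b_dist])
    show "cmod (fourier_coeff (W t) k) \<le> 1 * cmod (fourier_coeff b k)" for k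
      by (simp add: Wc norm_mult mult_left_le)
  qed
  \<comment> \<open>Used twice, for the pair U, V and for the pair V, W.\<close>
  have deriv: "tendsto_sobolev q (\<lambda>h \<phi>. (X (t + h) \<phi> - X t \<phi>) / complex_of_real h) (Y t) (at 0 within {-t..})"
    if X: "\<And>t. X t \<in> sobolev q" and Y: "Y t \<in> sobolev q"
      and Xc: "\<And>t k. fourier_coeff (X t) k = fourier_coeff b k * complex_of_real (x (\<omega> k) t)"
      and Yc: "\<And>t k. fourier_coeff (Y t) k = fourier_coeff b k * complex_of_real (y (\<omega> k) t)"
      and xy: "\<And>w t. (x w has_real_derivative y w t) (at t)"
      \<comment> \<open>The mean value theorem is applied between t and t + h with h of modulus at
        most 1.\<close>
      and B: "\<And>w s. \<bar>s\<bar> \<le> \<bar>t\<bar> + 1 \<Longrightarrow> \<bar>y w s\<bar> \<le> B"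
    for X Y :: "real \<Rightarrow> (real^'n \<Rightarrow> complex) \<Rightarrow> complex" and x y :: "real \<Rightarrow> real \<Rightarrow> real" and B t
  proof -
    have Sc: "fourier_coeff (\<lambda>\<phi>. (X (t + h) \<phi> - X t \<phi>) / complex_of_real h) k =
        fourier_coeff b k * complex_of_real ((x (\<omega> k) (t + h) - x (\<omega> k) t) / h)" for h k
      by (simp add: fourier_coeff_divide fourier_coeff_diff Xc right_diff_distrib)
    have quot: "\<bar>(x w (t + h) - x w t) / h\<bar> \<le> B" if "h \<noteq> 0" "\<bar>h\<bar> \<le> 1" for h w :: real
      using abs_difference_quotient_le[of "x w" "y w" t h B] xy B that by (simp add: divide_le_eq)
    have "\<forall>\<^sub>F h :: real in at 0 within {-t..}. h \<in> {-t..} \<and> h \<noteq> 0"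
      by (simp add: eventually_at_filter)
    moreover have "\<forall>\<^sub>F h :: real in at 0 within {-t..}. \<bar>h\<bar> < 1"
      unfolding eventually_at by (intro exI[of _ 1]) (auto simp: dist_real_def)
    ultimately have small: "\<forall>\<^sub>F h :: real in at 0 within {-t..}. h \<noteq> 0 \<and> \<bar>h\<bar> \<le> 1"
      by eventually_elim auto
    show ?thesis
    proof (rule tendsto_sobolev_dominated[OF Y])
      show "\<forall>\<^sub>F h :: real in at 0 within {-t..}. (\<lambda>\<phi>. (X (t + h) \<phi> - X t \<phi>) / complex_of_real h) \<in> sobolev q"
        using small
      proof eventually_elim
        fix h :: real assume h: "h \<noteq> 0 \<and> \<bar>h\<bar> \<le> 1"
        show "(\<lambda>\<phi>. (X (t + h) \<phi> - X t \<phi>) / complex_of_real h) \<in> sobolev q"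
        proof (rule sobolev_dominated[OF _ b, where B = B])
          show "(\<lambda>\<phi>. (X (t + h) \<phi> - X t \<phi>) / complex_of_real h) \<in> periodic_distributions"
            using X by (intro periodic_distributions_difference_quotient) (auto simp: sobolev_def)
          show "cmod (fourier_coeff (\<lambda>\<phi>. (X (t + h) \<phi> - X t \<phi>) / complex_of_real h) k) \<le> B * cmod (fourier_coeff b k)" for k
            unfolding Sc norm_mult norm_of_real
            using mult_left_mono[OF quot[of h "\<omega> k"], of "cmod (fourier_coeff b k)"] h by (simp add: mult.commute)
        qed
      qed
      \<comment> \<open>The difference quotient and its limit are each bounded by B, hence their
        difference by \<open>B + B\<close>.\<close>
      show "(\<lambda>k. (B + B)\<^sup>2 * (weight k powr q * (cmod (fourier_coeff b k))\<^sup>2)) summable_on UNIV"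
        by (intro summable_on_cmult_right sobolev_summable b)
      show "\<forall>\<^sub>F h :: real in at 0 within {-t..}. \<forall>k. weight k powr q *
          (cmod (fourier_coeff (\<lambda>\<phi>. (X (t + h) \<phi> - X t \<phi>) / complex_of_real h) k - fourier_coeff (Y t) k))\<^sup>2
          \<le> (B + B)\<^sup>2 * (weight k powr q * (cmod (fourier_coeff b k))\<^sup>2)"
        using small
      proof eventually_elim
        fix h :: real assume h: "h \<noteq> 0 \<and> \<bar>h\<bar> \<le> 1"
        show "\<forall>k. weight k powr q *
          (cmod (fourier_coeff (\<lambda>\<phi>. (X (t + h) \<phi> - X t \<phi>) / complex_of_real h) k - fourier_coeff (Y t) k))\<^sup>2
          \<le> (B + B)\<^sup>2 * (weight k powr q * (cmod (fourier_coeff b k))\<^sup>2)"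
        proof
          fix k
          let ?d = "(x (\<omega> k) (t + h) - x (\<omega> k) t) / h - y (\<omega> k) t"
          have "\<bar>?d\<bar> \<le> B + B" using quot[of h "\<omega> k"] B[of t "\<omega> k"] h by linarith
          then have "cmod (fourier_coeff b k * complex_of_real ?d) \<le> (B + B) * cmod (fourier_coeff b k)"
            unfolding norm_mult norm_of_real mult.commute[of "B + B"] by (rule mult_left_mono) simp
          from weighted_square_le[of k 0, OF _, of "fourier_coeff b k * complex_of_real ?d" "B + B" "fourier_coeff b k" q] this
          show "weight k powr q *
            (cmod (fourier_coeff (\<lambda>\<phi>. (X (t + h) \<phi> - X t \<phi>) / complex_of_real h) k - fourier_coeff (Y t) k))\<^sup>2
            \<le> (B + B)\<^sup>2 * (weight k powr q * (cmod (fourier_coeff b k))\<^sup>2)"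
            using weight_pos[of k]
            unfolding Sc Yc right_diff_distrib[symmetric] of_real_diff[symmetric] by simp
        qed
      qed
      fix k
      have "((\<lambda>h. (x (\<omega> k) (t + h) - x (\<omega> k) t) / h) \<longlongrightarrow> y (\<omega> k) t) (at 0 within {-t..})"
        using xy[of "\<omega> k" t, unfolded DERIV_def] by (rule tendsto_within_subset) simp
      then show "((\<lambda>h. fourier_coeff (\<lambda>\<phi>. (X (t + h) \<phi> - X t \<phi>) / complex_of_real h) k) \<longlongrightarrow>
          fourier_coeff (Y t) k) (at 0 within {-t..})"
        unfolding Sc Yc by (intro tendsto_mult tendsto_const tendsto_of_real)
    qed
  qed
  have dU: "tendsto_sobolev q (\<lambda>h \<phi>. (U (t + h) \<phi> - U t \<phi>) / complex_of_real h) (V t) (at 0 within {-t..})" for t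
    by (rule deriv[where X = U and Y = V and B = "\<bar>t\<bar> + 1", OF U V Uc Vc DERIV_wave_mode])
      (rule order_trans[OF abs_wave_velocity_le])
  have dV: "tendsto_sobolev q (\<lambda>h \<phi>. (V (t + h) \<phi> - V t \<phi>) / complex_of_real h) (W t) (at 0 within {-t..})" for t
    by (rule deriv[where X = V and Y = W and B = 1, OF V W Vc Wc DERIV_wave_velocity]) simp
  have zero: "U 0 \<phi> = 0" "V 0 \<phi> = 0" for \<phi>
    by (simp_all add: U_def V_def fourier_series_def)
  show ?thesis
    unfolding solves_wave_def using zero U V dU dV by (intro exI[of _ V]) (simp add: W_def)
qed

text \<open>For k = 0 the weight is 1 and the first summand suffices; for k \<noteq> 0 the second
  one does, by \<open>abs_wave_mode_le'\<close>.\<close>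

lemma weight_powr_wave_mode_le:
  assumes C: "C > 0" and \<omega>: "k \<noteq> 0 \<Longrightarrow> C * weight k powr r \<le> \<omega>\<^sup>2"
  shows "weight k powr r * \<bar>wave_mode \<omega> t\<bar> \<le> t\<^sup>2 / 2 + 2 / C"
proof (cases "k = 0")
  case True
  then have "weight k = 1" by (simp add: weight_def)
  then show ?thesis using abs_wave_mode_le[of \<omega> t] C by (simp add: add_increasing2)
next
  case False
  have pos: "0 < C * weight k powr r" using C weight_pos[of k] by simp
  then have "\<omega>\<^sup>2 > 0" using \<omega>[OF False] by linarith
  then have "\<omega> \<noteq> 0" by auto
  then have "weight k powr r * \<bar>wave_mode \<omega> t\<bar> \<le> weight k powr r * (2 / \<omega>\<^sup>2)"
    by (intro mult_left_mono abs_wave_mode_le') auto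
  also have "\<dots> \<le> weight k powr r * (2 / (C * weight k powr r))"
    using \<omega>[OF False] pos \<open>\<omega>\<^sup>2 > 0\<close> by (intro mult_left_mono divide_left_mono) auto
  also have "\<dots> = 2 / C" using weight_pos[of k] by simp
  finally show ?thesis by (simp add: add_increasing)
qed

section \<open>Lower bounds for the multiplier\<close>

text \<open>A nonzero integer vector has squared norm at least 1.\<close>

lemma norm_lattice_vec_ge:
  assumes "k \<noteq> 0"
  shows "(norm (lattice_vec k))\<^sup>2 \<ge> weight k / 2"
proof -
  obtain i where i: "k $ i \<noteq> 0" using assms by (auto simp: vec_eq_iff)
  have "(k $ i)\<^sup>2 \<ge> 1" using i by (smt (verit) zero_less_power2)
  then have "real_of_int ((k $ i)\<^sup>2) \<ge> 1" by linarith
  then have "1 \<le> (real_of_int (k $ i))\<^sup>2" by simp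
  also have "\<dots> \<le> (norm (lattice_vec k))\<^sup>2"
    unfolding norm_lattice_vec by (rule member_le_sum) auto
  finally show ?thesis by (simp add: weight_def)
qed

text \<open>This is - m_k in the parameter a = (n + 2 - \<beta>) / 2: the range \<beta> < n + 4
  becomes a > -1, and the limit \<beta> to n + 2 becomes a to 0.\<close>

definition symbol :: "real \<Rightarrow> real \<Rightarrow> int^'n \<Rightarrow> real" where
  "symbol \<delta> a k = (norm (lattice_vec k))\<^sup>2 *
    red2F3 (real CARD('n) / 2) a ((norm (lattice_vec k))\<^sup>2 * \<delta>\<^sup>2 / 4)"

lemma multiplier_eq_symbol:
  "multiplier \<delta> \<beta> (lattice_vec k) = - symbol \<delta> ((real CARD('n) + 2 - \<beta>) / 2) k"
  for k :: "int^'n"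
proof -
  have "(real CARD('n) + 2) / 2 = real CARD('n) / 2 + 1"
    "(real CARD('n) + 4 - \<beta>) / 2 = (real CARD('n) + 2 - \<beta>) / 2 + 1"
    by (auto simp: field_simps)
  moreover have "- (1 / 4) * (norm (lattice_vec k))\<^sup>2 * \<delta>\<^sup>2 = - ((norm (lattice_vec k))\<^sup>2 * \<delta>\<^sup>2 / 4)" by simp
  ultimately show ?thesis
    unfolding multiplier_def symbol_def by (simp only: hyp2F3_eq_red2F3)
qed

lemma symbol_0 [simp]: "symbol \<delta> a 0 = 0"
  by (simp add: symbol_def)

lemma CARD_half_ge: "real CARD('n::finite) / 2 \<ge> 1/2"
proof -
  have "CARD('n) \<ge> 1" by (simp add: Suc_leI)
  then show ?thesis by simp
qed

text \<open>One constant serves all a up to e, which makes the later majorant independent of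
  \<beta>. For 0 < a \<le> e the loss of a powers of the weight is at most a loss of e powers; for a
  \<le> 0 there is none.\<close>

lemma symbol_lower_uniform:
  assumes \<delta>: "\<delta> > 0" and e: "e \<ge> 0"
  obtains C where "C > 0"
    "\<And>a (k :: int^'n). -1 < a \<Longrightarrow> a \<le> e \<Longrightarrow> k \<noteq> 0 \<Longrightarrow> C * weight k powr (1 - e) \<le> symbol \<delta> a k"
proof -
  \<comment> \<open>Makes \<open>\<kappa> / weight k\<close> at most 1 and at most
    \<open>ln (3/2) / ?z\<close>, because the squared norm is at most the weight.\<close>
  define \<kappa> where "\<kappa> = min 1 (4 * ln (3/2) / \<delta>\<^sup>2)"
  have \<kappa>: "0 < \<kappa>" "\<kappa> \<le> 1" using \<delta> by (auto simp: \<kappa>_def)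
  show thesis
  proof (rule that[of "\<kappa> powr e / 4"])
    show "\<kappa> powr e / 4 > 0" using \<kappa> by simp
    fix a and k :: "int^'n" assume a: "-1 < a" "a \<le> e" and k: "k \<noteq> 0"
    let ?v = "real CARD('n) / 2"
    let ?z = "(norm (lattice_vec k))\<^sup>2 * \<delta>\<^sup>2 / 4"
    note w = weight_pos[of k] weight_ge_1[of k]
    have n: "(norm (lattice_vec k))\<^sup>2 \<ge> weight k / 2" by (rule norm_lattice_vec_ge[OF k])
    then have n0: "(norm (lattice_vec k))\<^sup>2 > 0" using w by linarith
    then have z: "?z > 0" using \<delta> by simp
    have kw: "0 < \<kappa> / weight k" "\<kappa> / weight k \<le> 1" using \<kappa> w by (auto simp: divide_le_eq)
    have "red2F3 ?v a ?z \<ge> 1/2 * (\<kappa> / weight k) powr e"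
    proof (cases "a > 0")
      case True
      have "\<kappa> / weight k \<le> ln (3/2) / ?z"
      proof -
        have "\<kappa> / weight k \<le> (4 * ln (3/2) / \<delta>\<^sup>2) / (norm (lattice_vec k))\<^sup>2"
          using \<kappa> n0 by (intro frac_le) (auto simp: \<kappa>_def weight_def)
        then show ?thesis by (simp add: mult_ac)
      qed
      then have m: "\<kappa> / weight k \<le> min 1 (ln (3/2) / ?z)" using kw by simp
      have "(\<kappa> / weight k) powr e \<le> (\<kappa> / weight k) powr a"
        using a kw by (intro powr_mono') auto
      also have "\<dots> \<le> (min 1 (ln (3/2) / ?z)) powr a"
        using True kw m by (intro powr_mono2) auto
      also have "1/2 * \<dots> \<le> red2F3 ?v a ?z"
        by (rule red2F3_lower_pos[OF CARD_half_ge True z])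
      finally show ?thesis by simp
    next
      case False
      have "(\<kappa> / weight k) powr e \<le> 1" by (rule powr_le1) (use kw e in linarith)+
      moreover have "red2F3 ?v a ?z \<ge> 1"
        using False by (intro red2F3_ge_1 CARD_half_ge a z) auto
      ultimately show ?thesis by simp
    qed
    then have "weight k / 2 * (1/2 * (\<kappa> / weight k) powr e) \<le> symbol \<delta> a k"
      unfolding symbol_def using n w by (intro mult_mono) auto
    moreover have "weight k / 2 * (1/2 * (\<kappa> / weight k) powr e) = \<kappa> powr e / 4 * weight k powr (1 - e)"
      using \<kappa> w by (simp add: powr_divide powr_diff)
    ultimately show "\<kappa> powr e / 4 * weight k powr (1 - e) \<le> symbol \<delta> a k" by simp
  qed
qed

text \<open>For a < 0 the symbol grows faster than the squared norm, the source of a gain above 2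
  derivatives. Here a is fixed and the constant may depend on it.\<close>

lemma symbol_lower_neg:
  assumes \<delta>: "\<delta> > 0" and a: "-1 < a" "a \<le> 0"
  obtains C where "C > 0" "\<And>k :: int^'n. k \<noteq> 0 \<Longrightarrow> C * weight k powr (1 - a) \<le> symbol \<delta> a k"
proof -
  let ?v = "real CARD('n) / 2"
  have v: "?v \<ge> 1/2" by (rule CARD_half_ge)
  \<comment> \<open>From z = |k|^2 \<delta>^2 / 4 and |k|^2 at least half the weight, z / (4 v) is
    at least \<kappa> times the weight.\<close>
  define \<kappa> where "\<kappa> = \<delta>\<^sup>2 / (32 * ?v)"
  have \<kappa>: "0 < \<kappa>" using \<delta> v by (simp add: \<kappa>_def)
  show thesis
  proof (rule that[of "\<kappa> powr (- a) / 4"])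
    show "\<kappa> powr (- a) / 4 > 0" using \<kappa> by simp
    fix k :: "int^'n" assume k: "k \<noteq> 0"
    let ?z = "(norm (lattice_vec k))\<^sup>2 * \<delta>\<^sup>2 / 4"
    note w = weight_pos[of k] weight_ge_1[of k]
    have n: "(norm (lattice_vec k))\<^sup>2 \<ge> weight k / 2" by (rule norm_lattice_vec_ge[OF k])
    then have "(norm (lattice_vec k))\<^sup>2 > 0" using w by linarith
    then have z: "?z > 0" using \<delta> by simp
    have kz: "\<kappa> * weight k \<le> ?z / (4 * ?v)"
    proof -
      have "\<delta>\<^sup>2 / (16 * ?v) * (weight k / 2) \<le> \<delta>\<^sup>2 / (16 * ?v) * (norm (lattice_vec k))\<^sup>2"
        by (intro mult_left_mono n) auto
      then show ?thesis by (simp add: \<kappa>_def mult_ac)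
    qed
    have "red2F3 ?v a ?z \<ge> 1/2 * (\<kappa> * weight k) powr (- a)"
    proof (cases "?z \<ge> 4 * ?v")
      case True
      have "(\<kappa> * weight k) powr (- a) \<le> (?z / (4 * ?v)) powr (- a)"
        using a \<kappa> w kz by (intro powr_mono2) auto
      also have "1/2 * \<dots> \<le> red2F3 ?v a ?z"
        by (rule red2F3_lower_neg[OF v a True])
      finally show ?thesis by simp
    next
      \<comment> \<open>Below 4 v the claimed bound is at most 1/2, so \<open>red2F3_ge_1\<close>
        suffices.\<close>
      case False
      have "?z / (4 * ?v) \<le> 1" using False v by (subst divide_le_eq) auto
      with kz have "\<kappa> * weight k \<le> 1" by (rule order_trans)
      then have "(\<kappa> * weight k) powr (- a) \<le> 1" using a \<kappa> w by (intro powr_le1) auto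
      moreover have "red2F3 ?v a ?z \<ge> 1" by (intro red2F3_ge_1 v a z)
      ultimately show ?thesis by simp
    qed
    then have "weight k / 2 * (1/2 * (\<kappa> * weight k) powr (- a)) \<le> symbol \<delta> a k"
      unfolding symbol_def using n w by (intro mult_mono) auto
    moreover have "weight k / 2 * (1/2 * (\<kappa> * weight k) powr (- a)) = \<kappa> powr (- a) / 4 * weight k powr (1 - a)"
      using powr_add[of "weight k" 1 "- a"] \<kappa> w by (simp add: powr_mult)
    ultimately show "\<kappa> powr (- a) / 4 * weight k powr (1 - a) \<le> symbol \<delta> a k" by simp
  qed
qed

text \<open>The uniform lower bound with e = max a 0 covers both signs of a.\<close>

lemma symbol_pos:
  fixes k :: "int^'n"
  assumes "\<delta> > 0" "a > -1" "k \<noteq> 0"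
  shows "symbol \<delta> a k > 0"
proof -
  obtain C where "C > 0" "C * weight k powr (1 - max a 0) \<le> symbol \<delta> a k"
    using symbol_lower_uniform[of \<delta> "max a 0"] assms by (metis max.cobounded1 max.cobounded2)
  moreover have "C * weight k powr (1 - max a 0) > 0" using \<open>C > 0\<close> weight_pos[of k] by simp
  ultimately show ?thesis by linarith
qed

lemma symbol_nonneg:
  assumes "\<delta> > 0" "a > -1"
  shows "symbol \<delta> a k \<ge> 0"
  using symbol_pos[OF assms, of k] by (cases "k = 0") auto

lemma symbol_tendsto:
  fixes k :: "int^'n"
  shows "((\<lambda>a. symbol \<delta> a k) \<longlongrightarrow> (norm (lattice_vec k))\<^sup>2) (at 0)"
proof -
  let ?v = "real CARD('n) / 2" and ?z = "(norm (lattice_vec k))\<^sup>2 * \<delta>\<^sup>2 / 4"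
  have "((\<lambda>a. red2F3 ?v a ?z - 1) \<longlongrightarrow> 0) (at 0)"
  proof (rule Lim_null_comparison)
    have "\<forall>\<^sub>F a :: real in at 0. a > -1"
      using order_tendstoD(1)[OF tendsto_ident_at, of "-1 :: real" 0 UNIV] by simp
    then show "\<forall>\<^sub>F a in at 0. norm (red2F3 ?v a ?z - 1) \<le> \<bar>a\<bar> / (a + 1) * (exp ?z - 1)"
      by eventually_elim (use abs_red2F3_minus_1_le[of ?v _ ?z] in simp)
    have "((\<lambda>a :: real. \<bar>a\<bar> / (a + 1) * (exp ?z - 1)) \<longlongrightarrow> \<bar>0\<bar> / (0 + 1) * (exp ?z - 1)) (at 0)"
      by (intro tendsto_intros) auto
    then show "((\<lambda>a :: real. \<bar>a\<bar> / (a + 1) * (exp ?z - 1)) \<longlongrightarrow> 0) (at 0)" by simp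
  qed
  then have "((\<lambda>a. red2F3 ?v a ?z) \<longlongrightarrow> 1) (at 0)" by (simp add: LIM_zero_iff)
  from tendsto_mult[OF tendsto_const[of "(norm (lattice_vec k))\<^sup>2"] this]
  show ?thesis by (simp add: symbol_def)
qed

section \<open>The two wave equations\<close>

lemma local_wave_eq:
  "local_wave b t = fourier_series (\<lambda>k. fourier_coeff b k * complex_of_real (wave_mode (norm (lattice_vec k)) t))"
proof -
  have z: "norm (lattice_vec k) = 0 \<longleftrightarrow> k = 0" for k :: "int^'n"
    by (auto simp: lattice_vec_def vec_eq_iff)
  show ?thesis
    unfolding local_wave_def
    by (rule arg_cong[where f = fourier_series])
      (auto simp: fun_eq_iff wave_mode_def z field_simps simp del: norm_eq_zero)
qed

lemma nonlocal_wave_eq: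
  fixes b :: "(real^'n \<Rightarrow> complex) \<Rightarrow> complex"
  assumes \<delta>: "\<delta> > 0" and \<beta>: "\<beta> < real CARD('n) + 4"
  shows "nonlocal_wave \<delta> \<beta> b t = fourier_series (\<lambda>k. fourier_coeff b k *
    complex_of_real (wave_mode (sqrt (symbol \<delta> ((real CARD('n) + 2 - \<beta>) / 2) k)) t))"
proof -
  let ?s = "symbol \<delta> ((real CARD('n) + 2 - \<beta>) / 2) :: int^'n \<Rightarrow> real"
  have p: "?s k > 0" if "k \<noteq> 0" for k
    using \<beta> that by (intro symbol_pos \<delta>) auto
  have "(if k = 0 then fourier_coeff b 0 * complex_of_real (t\<^sup>2 / 2)
      else let m = multiplier \<delta> \<beta> (lattice_vec k) in
        fourier_coeff b k / complex_of_real m * complex_of_real (cos (sqrt (- m) * t) - 1)) =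
      fourier_coeff b k * complex_of_real (wave_mode (sqrt (?s k)) t)" for k
  proof (cases "k = 0")
    case True
    then show ?thesis by (simp add: wave_mode_def)
  next
    case False
    have "wave_mode (sqrt (?s k)) t = (cos (sqrt (?s k) * t) - 1) / - ?s k"
      using p[OF False] by (simp add: wave_mode_def divide_simps)
    then have w: "complex_of_real (wave_mode (sqrt (?s k)) t) =
        complex_of_real (cos (sqrt (?s k) * t) - 1) / complex_of_real (- ?s k)"
      by (simp only: of_real_divide)
    show ?thesis
      unfolding w multiplier_eq_symbol Let_def using False by simp
  qed
  then show ?thesis unfolding nonlocal_wave_def by simp
qed

theorem theorem19:
  fixes \<delta> \<sigma> :: real
    and b :: "(real^'n \<Rightarrow> complex) \<Rightarrow> complex"
  assumes "\<delta> > 0"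
    and "b \<in> sobolev \<sigma>"
  shows "(\<forall>\<beta> < real CARD('n) + 4.
           solves_wave \<sigma> (nonlocal_laplacian \<delta> \<beta>) b (nonlocal_wave \<delta> \<beta> b) \<and>
           (\<forall>t\<ge>0. nonlocal_wave \<delta> \<beta> b t \<in> sobolev (\<sigma> + max 0 (\<beta> - real CARD('n))))) \<and>
         solves_wave \<sigma> laplacian b (local_wave b) \<and>
         (\<forall>t\<ge>0. local_wave b t \<in> sobolev (\<sigma> + 2)) \<and>
         (\<forall>t\<ge>0. \<forall>\<epsilon>. 0 < \<epsilon> \<and> \<epsilon> < 2 \<and> \<epsilon> < real CARD('n) / 2 \<longrightarrow>
           tendsto_sobolev (\<sigma> + 2 - \<epsilon>) (\<lambda>\<beta>. nonlocal_wave \<delta> \<beta> b t) (local_wave b t)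
             (at (real CARD('n) + 2)))"
proof -
  note \<delta> = assms(1) and b = assms(2)
  define a where "a = (\<lambda>\<beta>. (real CARD('n) + 2 - \<beta>) / 2)"
  define \<omega> :: "real \<Rightarrow> int^'n \<Rightarrow> real" where "\<omega> = (\<lambda>\<beta> k. sqrt (symbol \<delta> (a \<beta>) k))"
  define N :: "int^'n \<Rightarrow> real" where "N = (\<lambda>k. norm (lattice_vec k))"
  have loc: "local_wave b t = fourier_series (\<lambda>k. fourier_coeff b k * complex_of_real (wave_mode (N k) t))" for t
    by (simp add: local_wave_eq N_def)
  have nonloc: "nonlocal_wave \<delta> \<beta> b t = fourier_series (\<lambda>k. fourier_coeff b k * complex_of_real (wave_mode (\<omega> \<beta> k) t))"
    if "\<beta> < real CARD('n) + 4" for \<beta> t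
    using nonlocal_wave_eq[OF \<delta> that] by (simp add: \<omega>_def a_def)
  have \<omega>2: "(\<omega> \<beta> k)\<^sup>2 = symbol \<delta> (a \<beta>) k" if "\<beta> < real CARD('n) + 4" for \<beta> k
    using symbol_nonneg[OF \<delta>, of "a \<beta>" k] that by (simp add: \<omega>_def a_def)
  have b_dist: "b \<in> periodic_distributions" using b by (simp add: sobolev_def)
  have mode_bound: "weight k powr r * cmod (fourier_coeff b k * complex_of_real (wave_mode w t)) \<le>
      (t\<^sup>2 / 2 + 2 / C) * cmod (fourier_coeff b k)"
    if "C > 0" "k \<noteq> 0 \<Longrightarrow> C * weight k powr r \<le> w\<^sup>2" for k r w t C
    using mult_right_mono[OF weight_powr_wave_mode_le[of C k r w t, OF that], of "cmod (fourier_coeff b k)"]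
    by (simp add: norm_mult mult_ac)
  have N_lower: "1/2 * weight k powr 1 \<le> (N k)\<^sup>2" if "k \<noteq> 0" for k
    using norm_lattice_vec_ge[OF that] weight_pos[of k] by (simp add: N_def)

  \<comment> \<open>Regularity of the nonlocal solution\<close>
  have reg: "nonlocal_wave \<delta> \<beta> b t \<in> sobolev (\<sigma> + max 0 (\<beta> - real CARD('n)))"
    if \<beta>: "\<beta> < real CARD('n) + 4" for \<beta> t
  \<comment> \<open>This case is \<beta> \<le> n, where no gain is claimed and the bound t^2 / 2 on
    the modes is enough.\<close>
  proof (cases "a \<beta> \<ge> 1")
    case True
    then have "max 0 (\<beta> - real CARD('n)) = 0" by (simp add: a_def)
    moreover have "nonlocal_wave \<delta> \<beta> b t \<in> sobolev \<sigma>"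
      unfolding nonloc[OF \<beta>]
    proof (rule fourier_series_sobolev_dominated[OF b, where B = "t\<^sup>2 / 2"])
      show "cmod (fourier_coeff b k * complex_of_real (wave_mode (\<omega> \<beta> k) t)) \<le> t\<^sup>2 / 2 * cmod (fourier_coeff b k)" for k
        using mult_left_mono[OF abs_wave_mode_le[of "\<omega> \<beta> k" t], of "cmod (fourier_coeff b k)"]
        by (simp add: norm_mult mult.commute)
    qed
    ultimately show ?thesis by simp
  next
    case False
    then have m: "max 0 (\<beta> - real CARD('n)) = 2 * (1 - a \<beta>)" by (auto simp: a_def max_def field_simps)
    have a1: "a \<beta> > -1" using \<beta> by (simp add: a_def)
    \<comment> \<open>For a \<ge> 0 the uniform bound is taken with e = a itself, which gives the
      exact exponent.\<close>
    obtain C where C: "C > 0" "\<And>k :: int^'n. k \<noteq> 0 \<Longrightarrow> C * weight k powr (1 - a \<beta>) \<le> symbol \<delta> (a \<beta>) k"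
    proof (cases "a \<beta> \<ge> 0")
      case True
      show thesis
        by (rule symbol_lower_uniform[where 'n = 'n, OF \<delta> True]) (use a1 that in blast)
    next
      case False
      then show thesis
        using symbol_lower_neg[where 'n = 'n, OF \<delta> a1] that by (metis linear)
    qed
    show ?thesis
      unfolding m nonloc[OF \<beta>]
      by (rule fourier_series_sobolev_gain[OF b mode_bound[OF C(1)]]) (simp add: \<omega>2[OF \<beta>] C(2))
  qed

  \<comment> \<open>The nonlocal wave equation\<close>
  have nonlocal_solves: "solves_wave \<sigma> (nonlocal_laplacian \<delta> \<beta>) b (nonlocal_wave \<delta> \<beta> b)"
    if \<beta>: "\<beta> < real CARD('n) + 4" for \<beta>
  proof -
    have "solves_wave \<sigma> (nonlocal_laplacian \<delta> \<beta>) b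
        (\<lambda>t. fourier_series (\<lambda>k. fourier_coeff b k * complex_of_real (wave_mode (\<omega> \<beta> k) t)))"
    proof (rule solves_wave_series[OF b])
      fix t
      let ?U = "fourier_series (\<lambda>k. fourier_coeff b k * complex_of_real (wave_mode (\<omega> \<beta> k) t))"
      have L: "nonlocal_laplacian \<delta> \<beta> ?U = fourier_series (\<lambda>k. - complex_of_real ((\<omega> \<beta> k)\<^sup>2) *
          (fourier_coeff b k * complex_of_real (wave_mode (\<omega> \<beta> k) t)))"
        unfolding nonlocal_laplacian_def multiplier_eq_symbol by (simp add: \<omega>2[OF \<beta>] a_def)
      show "fourier_coeff (nonlocal_laplacian \<delta> \<beta> ?U) k = - complex_of_real ((\<omega> \<beta> k)\<^sup>2) * fourier_coeff ?U k" for k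
        unfolding L by simp
      have "nonlocal_laplacian \<delta> \<beta> ?U \<in> sobolev \<sigma>"
        unfolding L
      \<comment> \<open>For \<omega> \<noteq> 0, \<omega>^2 times the mode is 1 - cos(\<omega> t),
        at most 2, and for \<omega> = 0 it vanishes; so the operator maps U into the space of
        b.\<close>
      proof (rule fourier_series_sobolev_dominated[OF b, where B = 2])
        fix k
        have "(\<omega> \<beta> k)\<^sup>2 * \<bar>wave_mode (\<omega> \<beta> k) t\<bar> \<le> 2"
          using abs_wave_mode_le'[of "\<omega> \<beta> k" t] by (cases "\<omega> \<beta> k = 0") (auto simp: field_simps)
        from mult_right_mono[OF this, of "cmod (fourier_coeff b k)"]
        show "cmod (- complex_of_real ((\<omega> \<beta> k)\<^sup>2) * (fourier_coeff b k * complex_of_real (wave_mode (\<omega> \<beta> k) t)))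
            \<le> 2 * cmod (fourier_coeff b k)"
          by (simp add: norm_mult norm_power mult_ac)
      qed
      then show "nonlocal_laplacian \<delta> \<beta> ?U \<in> periodic_distributions" by (simp add: sobolev_def)
    qed
    moreover have "nonlocal_wave \<delta> \<beta> b =
        (\<lambda>t. fourier_series (\<lambda>k. fourier_coeff b k * complex_of_real (wave_mode (\<omega> \<beta> k) t)))"
      by (rule ext) (rule nonloc[OF \<beta>])
    ultimately show ?thesis by simp
  qed

  \<comment> \<open>The local solution\<close>
  have local_reg: "local_wave b t \<in> sobolev (\<sigma> + 2 * 1)" for t
    unfolding loc
    by (rule fourier_series_sobolev_gain[OF b mode_bound[of "1/2"]]) (simp, erule N_lower)

  have local_solves: "solves_wave \<sigma> laplacian b (local_wave b)"
  proof -
    have d: "fourier_series (\<lambda>k. fourier_coeff b k * complex_of_real (wave_mode (N k) t)) \<in> periodic_distributions" for t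
      using local_reg[of t] by (simp add: loc sobolev_def)
    have "solves_wave \<sigma> laplacian b
        (\<lambda>t. fourier_series (\<lambda>k. fourier_coeff b k * complex_of_real (wave_mode (N k) t)))"
      by (rule solves_wave_series[where \<omega> = N and A = laplacian, OF b laplacian_distribution[OF d]])
        (subst fourier_coeff_laplacian[OF d], simp only: N_def)
    moreover have "local_wave b =
        (\<lambda>t. fourier_series (\<lambda>k. fourier_coeff b k * complex_of_real (wave_mode (N k) t)))"
      by (rule ext) (rule loc)
    ultimately show ?thesis by simp
  qed

  \<comment> \<open>Convergence as \<beta> tends to n + 2\<close>
  have conv: "tendsto_sobolev (\<sigma> + 2 - \<epsilon>) (\<lambda>\<beta>. nonlocal_wave \<delta> \<beta> b t) (local_wave b t) (at (real CARD('n) + 2))"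
    if \<epsilon>: "0 < \<epsilon>" for t \<epsilon>
  proof -
    let ?F = "at (real CARD('n) + 2)"
    \<comment> \<open>The \<epsilon> / 2 given up here absorbs the loss for \<beta> < n + 2, where a
      is positive but eventually at most \<epsilon> / 2.\<close>
    define r where "r = 1 - \<epsilon> / 2"
    have r: "\<sigma> + 2 - \<epsilon> = \<sigma> + 2 * r" by (simp add: r_def)
    obtain C where C: "C > 0" "\<And>a (k :: int^'n). -1 < a \<Longrightarrow> a \<le> \<epsilon> / 2 \<Longrightarrow> k \<noteq> 0 \<Longrightarrow>
        C * weight k powr r \<le> symbol \<delta> a k"
      unfolding r_def using symbol_lower_uniform[where 'n = 'n, OF \<delta>, of "\<epsilon> / 2"] \<epsilon> by auto
    \<comment> \<open>The nonlocal bound plus the local one, whose lower constant is 1/2.\<close>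
    define B where "B = (t\<^sup>2 / 2 + 2 / C) + (t\<^sup>2 / 2 + 2 / (1/2))"
    have alim: "(a \<longlongrightarrow> 0) ?F"
    proof -
      have "(a \<longlongrightarrow> (real CARD('n) + 2 - (real CARD('n) + 2)) / 2) ?F"
        unfolding a_def by (intro tendsto_intros) auto
      then show ?thesis by simp
    qed
    have near: "\<forall>\<^sub>F \<beta> in ?F. -1 < a \<beta> \<and> a \<beta> \<le> \<epsilon> / 2"
      using order_tendstoD(1)[OF alim, of "-1"] order_tendstoD(2)[OF alim, of "\<epsilon> / 2"] \<epsilon>
      by (auto elim: eventually_elim2)
    have bound: "weight k powr r * cmod (fourier_coeff b k * complex_of_real (wave_mode (\<omega> \<beta> k) t)) \<le>
        (t\<^sup>2 / 2 + 2 / C) * cmod (fourier_coeff b k)"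
      if "-1 < a \<beta> \<and> a \<beta> \<le> \<epsilon> / 2" for \<beta> k
      using that by (intro mode_bound C(1)) (subst \<omega>2, auto simp: a_def intro!: C(2))
    have bound': "weight k powr r * cmod (fourier_coeff b k * complex_of_real (wave_mode (N k) t)) \<le>
        (t\<^sup>2 / 2 + 2 / (1/2)) * cmod (fourier_coeff b k)" for k
    proof (rule mode_bound)
      assume "k \<noteq> 0"
      have "weight k powr r \<le> weight k powr 1" using \<epsilon> weight_ge_1 by (intro powr_mono) (auto simp: r_def)
      then show "1/2 * weight k powr r \<le> (N k)\<^sup>2" using N_lower[OF \<open>k \<noteq> 0\<close>] by linarith
    qed simp
    show ?thesis
      unfolding r
    proof (rule tendsto_sobolev_dominated)
      show "local_wave b t \<in> sobolev (\<sigma> + 2 * r)"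
        unfolding loc by (rule fourier_series_sobolev_gain[OF b bound'])
      show "\<forall>\<^sub>F \<beta> in ?F. nonlocal_wave \<delta> \<beta> b t \<in> sobolev (\<sigma> + 2 * r)"
        using near
      proof eventually_elim
        fix \<beta> assume n: "-1 < a \<beta> \<and> a \<beta> \<le> \<epsilon> / 2"
        then have "\<beta> < real CARD('n) + 4" by (simp add: a_def)
        from nonloc[OF this, of t] fourier_series_sobolev_gain[OF b bound[OF n]]
        show "nonlocal_wave \<delta> \<beta> b t \<in> sobolev (\<sigma> + 2 * r)" by simp
      qed
      show "(\<lambda>k. B\<^sup>2 * (weight k powr \<sigma> * (cmod (fourier_coeff b k))\<^sup>2)) summable_on UNIV"
        by (intro summable_on_cmult_right sobolev_summable b)
      show "\<forall>\<^sub>F \<beta> in ?F. \<forall>k. weight k powr (\<sigma> + 2 * r) *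
          (cmod (fourier_coeff (nonlocal_wave \<delta> \<beta> b t) k - fourier_coeff (local_wave b t) k))\<^sup>2
          \<le> B\<^sup>2 * (weight k powr \<sigma> * (cmod (fourier_coeff b k))\<^sup>2)"
        using near
      proof eventually_elim
        fix \<beta> assume n: "-1 < a \<beta> \<and> a \<beta> \<le> \<epsilon> / 2"
        then have \<beta>: "\<beta> < real CARD('n) + 4" by (simp add: a_def)
        show "\<forall>k. weight k powr (\<sigma> + 2 * r) *
          (cmod (fourier_coeff (nonlocal_wave \<delta> \<beta> b t) k - fourier_coeff (local_wave b t) k))\<^sup>2
          \<le> B\<^sup>2 * (weight k powr \<sigma> * (cmod (fourier_coeff b k))\<^sup>2)"
        proof (intro allI weighted_square_le)
          fix k
          let ?p = "fourier_coeff b k * complex_of_real (wave_mode (\<omega> \<beta> k) t)"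
          let ?q = "fourier_coeff b k * complex_of_real (wave_mode (N k) t)"
          have "weight k powr r * cmod (?p - ?q) \<le> weight k powr r * (cmod ?p + cmod ?q)"
            by (intro mult_left_mono norm_triangle_ineq4) auto
          also have "\<dots> \<le> B * cmod (fourier_coeff b k)"
            using add_mono[OF bound[OF n, of k] bound'[of k]] by (simp only: B_def distrib_left distrib_right)
          finally show "weight k powr r * cmod (fourier_coeff (nonlocal_wave \<delta> \<beta> b t) k - fourier_coeff (local_wave b t) k)
              \<le> B * cmod (fourier_coeff b k)"
            by (simp add: nonloc[OF \<beta>] loc)
        qed
      qed
      fix k :: "int^'n"
      have "((\<lambda>\<beta>. wave_mode (\<omega> \<beta> k) t) \<longlongrightarrow> wave_mode (N k) t) ?F"
      proof (cases "k = 0")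
        \<comment> \<open>Both frequencies vanish, so the zero modes coincide for every
          \<beta>.\<close>
        case True
        then show ?thesis by (simp add: \<omega>_def N_def)
      next
        case False
        then have N0: "N k \<noteq> 0" using N_lower[OF False] weight_pos[of k] by (auto simp: power2_eq_square)
        \<comment> \<open>\<open>symbol_tendsto\<close> is a limit over a punctured neighbourhood of
          0, so a must avoid 0; it does, as \<beta> \<noteq> n + 2 along this filter.\<close>
        have "\<forall>\<^sub>F \<beta> in ?F. a \<beta> \<noteq> 0" unfolding eventually_at by (intro exI[of _ 1]) (auto simp: a_def)
        then have "filterlim a (at 0) ?F" using alim by (simp add: filterlim_at)
        from filterlim_compose[OF symbol_tendsto this]
        have "((\<lambda>\<beta>. symbol \<delta> (a \<beta>) k) \<longlongrightarrow> (N k)\<^sup>2) ?F" by (simp add: N_def)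
        from tendsto_real_sqrt[OF this] have \<omega>lim: "((\<lambda>\<beta>. \<omega> \<beta> k) \<longlongrightarrow> N k) ?F"
          by (simp add: \<omega>_def N_def)
        have "((\<lambda>\<beta>. (1 - cos (\<omega> \<beta> k * t)) / (\<omega> \<beta> k)\<^sup>2) \<longlongrightarrow> (1 - cos (N k * t)) / (N k)\<^sup>2) ?F"
          using N0 by (intro tendsto_intros \<omega>lim) auto
        \<comment> \<open>Near a nonzero limit the frequencies are nonzero, so the second branch of
          \<open>wave_mode\<close> applies.\<close>
        moreover have "\<forall>\<^sub>F \<beta> in ?F. (1 - cos (\<omega> \<beta> k * t)) / (\<omega> \<beta> k)\<^sup>2 = wave_mode (\<omega> \<beta> k) t"
          using tendsto_imp_eventually_ne[OF \<omega>lim N0] by eventually_elim (simp add: wave_mode_def)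
        ultimately show ?thesis
          using N0 by (simp add: wave_mode_def[of "N k"] tendsto_cong)
      qed
      then have "((\<lambda>\<beta>. fourier_coeff b k * complex_of_real (wave_mode (\<omega> \<beta> k) t)) \<longlongrightarrow>
          fourier_coeff b k * complex_of_real (wave_mode (N k) t)) ?F"
        by (intro tendsto_intros)
      moreover have "\<forall>\<^sub>F \<beta> in ?F. fourier_coeff b k * complex_of_real (wave_mode (\<omega> \<beta> k) t) =
          fourier_coeff (nonlocal_wave \<delta> \<beta> b t) k"
        using near by eventually_elim (subst nonloc, auto simp: a_def)
      ultimately show "((\<lambda>\<beta>. fourier_coeff (nonlocal_wave \<delta> \<beta> b t) k) \<longlongrightarrow> fourier_coeff (local_wave b t) k) ?F"
        by (simp add: loc tendsto_cong)
    qed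
  qed
  show ?thesis
    using reg nonlocal_solves local_reg local_solves conv by auto
qed

end
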